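(* Let $(\mathcal{R},\partial)$ be a commutative differential ring with ring of constants $\mathcal{C}$ and a quasi-integration $\mathrm{Q}$, let $\mathcal{R}_{\mathrm{T}}=\ker\mathrm{Q}$, and let $\mathcal{C}_2$ be the $\mathcal{C}$-algebra defined in the context. Let $\mathbb{Q}\subseteq\mathcal{C}$ and let $\mathcal{R}_{\mathrm{T}}$ be generated as a $\mathcal{C}$-module by $\{a_i\mid i\in I\}\subseteq\mathcal{R}_{\mathrm{T}}$. Let $\le$ be a total order on $I$, and let $S$ be the set of all pairs $(V,W)$ of nonempty words over $I$ such that $V\le_{\mathrm{dlex}}W$, $V$ is a Lyndon word, and $W$ is not the maximal shuffle of some nonempty words $W_1,W_2\in\langle I\rangle^*$ with $W_1<_{\mathrm{dlex}}V$. Then $\mathcal{C}_2$ is generated as a $\mathcal{C}$-algebra by the set $\{c(V,W)\mid(V,W)\in S\}$, where $c(V,W)=\varepsilon\big((a_{v_1}\otimes\dots\otimes a_{v_{|V|}})\odot(a_{w_1}\otimes\dots\otimes a_{w_{|W|}})\big)$ for $V=v_1\dots v_{|V|}$ and $W=w_1\dots w_{|W|}$.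
   Context: Rings and algebras have a unit. A differential ring is a ring with an additive map $\partial$ satisfying the Leibniz rule; its ring of constants is $\ker\partial$. $\mathbb{Q}\subseteq\mathcal{C}$ means that $\mathbb{Q}$ is a subring of $\mathcal{C}$. Setting: $(\mathcal{R},\partial)$ is a commutative differential ring, $\mathcal{C}=\ker\partial$; tensor and symmetric products are over $\mathcal{C}$. A quasi-integration is a $\mathcal{C}$-linear $\mathrm{Q}:\mathcal{R}\to\mathcal{R}$ with $\partial\mathrm{Q}\partial=\partial$ and $\mathrm{Q}\partial\mathrm{Q}=\mathrm{Q}$. $\mathcal{T}=\bigoplus_{n\ge0}\mathcal{R}_{\mathrm{T}}^{\otimes n}$ with empty tensor $1_{\mathcal{T}}$; $\widetilde{\mathcal{T}}=\bigoplus_{n\ge1}\mathcal{R}_{\mathrm{T}}^{\otimes n}$. The shuffle product $\sqcup\!\sqcup$ on $\mathcal{T}$ is the $\mathcal{C}$-bilinear product with $t\sqcup\!\sqcup s=t\otimes s$ if $t$ or $s$ has length $0$ and $t\sqcup\!\sqcup s=t_1\otimes((t_2\otimes\dots\otimes t_n)\sqcup\!\sqcup s)+s_1\otimes(t\sqcup\!\sqcup(s_2\otimes\dots\otimes s_m))$ for pure tensors of lengths $n,m\ge1$. For a pure tensor $f=f_1\otimes\dots\otimes f_n$, $f_i^j:=f_i\otimes\dots\otimes f_j$, and $f_i^j=1_{\mathcal{T}}$ if $i=j+1$. $M_2=\widetilde{\mathcal{T}}^{\odot2}$ (symmetric square), $\varepsilon(M_2)$ is an isomorphic copy with isomorphism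 $\varepsilon:M_2\to\varepsilon(M_2)$, and $\mathcal{C}_2=\mathrm{Sym}(\varepsilon(M_2))/J_2$ (unital symmetric $\mathcal{C}$-algebra modulo an ideal), where $J_2$ is the ideal generated by all $$\varepsilon((f\sqcup\!\sqcup g)\odot h)-\varepsilon(f\odot(g\sqcup\!\sqcup h))+\sum_{j=0}^{m-1}\Big(\sum_{i=\max(0,1-j)}^{n-1}\varepsilon(f_{i+1}^n\odot g_{j+1}^m)\cdot\varepsilon((f_1^i\sqcup\!\sqcup g_1^j)\odot h)-\sum_{k=\max(0,1-j)}^{l-1}\varepsilon(f\odot(g_1^j\sqcup\!\sqcup h_1^k))\cdot\varepsilon(g_{j+1}^m\odot h_{k+1}^l)\Big)$$ for $n,m,l\ge1$ and pure tensors $f\in\mathcal{R}_{\mathrm{T}}^{\otimes n}$, $g\in\mathcal{R}_{\mathrm{T}}^{\otimes m}$, $h\in\mathcal{R}_{\mathrm{T}}^{\otimes l}$. In the claim, $c(V,W)$ is regarded as an element of $\mathcal{C}_2$ (its class). Words: $\langle I\rangle$ is the free monoid of words over $I$, $\langle I\rangle^*$ the set of nonempty words, $|W|$ the length. $\le_{\mathrm{dlex}}$ is the degree-lexicographic order: compare first by length, then lexicographically w.r.t. $\le$. The set of shuffles is $\mathrm{sh}(V,W)=\{VW\}$ if $V$ or $W$ is empty, and otherwise $\mathrm{sh}(V,W)=\{v_1U\mid U\in\mathrm{sh}(v_2\dots v_{|V|},W)\}\cup\{w_1U\mid U\in\mathrm{sh}(V,w_2\dots w_{|W|})\}$; the maximal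 shuffle of $V$ and $W$ is the lexicographically greatest element of $\mathrm{sh}(V,W)$. A word is a Lyndon word if it is nonempty and all its proper nonempty suffixes are lexicographically greater than it. *)

theory Defs
  imports
    Complex_Main
    "HOL-Library.Multiset"
    "HOL-Library.Poly_Mapping"
    "HOL-Library.Sublist"
    "HOL-Algebra.Module"
    "HOL-Algebra.QuotRing"
    "HOL-Algebra.Generated_Rings"
begin

section \<open>Differential rings and quasi-integrations\<close>

locale differential_ring =
  fixes d :: "'a::comm_ring_1 \<Rightarrow> 'a"
  assumes d_add: "d (x + y) = d x + d y"
    and d_mult: "d (x * y) = d x * y + x * d y"

definition constants :: "('a::comm_ring_1 \<Rightarrow> 'a) \<Rightarrow> 'a set"
  where "constants d = {c. d c = 0}"

locale quasi_integration = differential_ring d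
  for d :: "'a::comm_ring_1 \<Rightarrow> 'a" +
  fixes Q :: "'a \<Rightarrow> 'a"
  assumes Q_add: "Q (x + y) = Q x + Q y"
    and Q_scale: "c \<in> constants d \<Longrightarrow> Q (c * x) = c * Q x"
    and dQd: "d (Q (d x)) = d x"
    and QdQ: "Q (d (Q x)) = Q x"

text \<open>
  The ground ring of all constructions below is a subring \<open>K\<close> of a ring type, packaged as a
  record by \<open>subring_of K\<close>.
\<close>

definition subring_of :: "'a::comm_ring_1 set \<Rightarrow> 'a ring"
  where "subring_of K = \<lparr>carrier = K, mult = (*), one = 1, zero = 0, add = (+)\<rparr>"

definition contains_rationals :: "'a::comm_ring_1 set \<Rightarrow> bool"
  where "contains_rationals K \<longleftrightarrow>
    (\<exists>h. h \<in> ring_hom (subring_of (UNIV :: rat set)) (subring_of K) \<and> inj h)"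

definition regular_module :: "('a::comm_ring_1, 'a) module"
  where "regular_module =
    \<lparr>carrier = UNIV, mult = (*), one = 1, zero = 0, add = (+), smult = (*)\<rparr>"

definition kernel_module :: "('a::comm_ring_1 \<Rightarrow> 'a) \<Rightarrow> ('a, 'a) module"
  where "kernel_module Q = regular_module\<lparr>carrier := {x. Q x = 0}\<rparr>"


section \<open>Modules given by generators and relations\<close>

definition mod_span ::
    "'a::comm_ring_1 set \<Rightarrow> ('a, 'm, 'z) module_scheme \<Rightarrow> 'm set \<Rightarrow> 'm set"
  where "mod_span K M X = \<Inter>{N. submodule N (subring_of K) M \<and> X \<subseteq> N}"

text \<open>
  Modules are records extending rings; the ring multiplication and unit of the modules below
  are irrelevant.
\<close>

definition fscale :: "'a::comm_ring_1 \<Rightarrow> ('s \<Rightarrow>\<^sub>0 'a) \<Rightarrow> ('s \<Rightarrow>\<^sub>0 'a)"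
  where "fscale c p = Poly_Mapping.map ((*) c) p"

definition free_module :: "'a::comm_ring_1 set \<Rightarrow> 's set \<Rightarrow> ('a, 's \<Rightarrow>\<^sub>0 'a) module"
  where "free_module K X =
    \<lparr>carrier = {p. Poly_Mapping.keys p \<subseteq> X \<and> Poly_Mapping.range p \<subseteq> K},
     mult = undefined, one = undefined, zero = 0, add = (+), smult = fscale\<rparr>"

definition quot_module :: "('a, 'm, 'z) module_scheme \<Rightarrow> 'm set \<Rightarrow> ('a, 'm set) module"
  where "quot_module M N =
    \<lparr>carrier = a_rcosets\<^bsub>M\<^esub> N, mult = undefined, one = undefined, zero = N, add = set_add M,
     smult = (\<lambda>c X. \<Union>x\<in>X. N +>\<^bsub>M\<^esub> (c \<odot>\<^bsub>M\<^esub> x))\<rparr>"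


section \<open>The tensor algebra and the shuffle product\<close>

text \<open>
  The direct sum of all tensor powers of \<open>M\<close> is the free module on the words over \<open>M\<close> modulo
  multilinearity in each letter; these relations are homogeneous with respect to word length.
\<close>

definition word_module ::
    "'a::comm_ring_1 set \<Rightarrow> ('a, 'm, 'z) module_scheme \<Rightarrow> ('a, 'm list \<Rightarrow>\<^sub>0 'a) module"
  where "word_module K M = free_module K (lists (carrier M))"

definition tensor_rels ::
    "'a::comm_ring_1 set \<Rightarrow> ('a, 'm, 'z) module_scheme \<Rightarrow> ('m list \<Rightarrow>\<^sub>0 'a) set"
  where "tensor_rels K M = mod_span K (word_module K M)
    ({Poly_Mapping.single (u @ (x \<oplus>\<^bsub>M\<^esub> y) # v) 1
        - Poly_Mapping.single (u @ x # v) 1 - Poly_Mapping.single (u @ y # v) 1 | u v x y.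
        u \<in> lists (carrier M) \<and> v \<in> lists (carrier M) \<and> x \<in> carrier M \<and> y \<in> carrier M} \<union>
     {Poly_Mapping.single (u @ (c \<odot>\<^bsub>M\<^esub> x) # v) 1 - Poly_Mapping.single (u @ x # v) c | u v c x.
        u \<in> lists (carrier M) \<and> v \<in> lists (carrier M) \<and> c \<in> K \<and> x \<in> carrier M})"

definition tensor_module ::
    "'a::comm_ring_1 set \<Rightarrow> ('a, 'm, 'z) module_scheme \<Rightarrow> ('a, ('m list \<Rightarrow>\<^sub>0 'a) set) module"
  where "tensor_module K M = quot_module (word_module K M) (tensor_rels K M)"

text \<open>The pure tensor with the letters of \<open>u\<close> as factors; the empty word gives the empty tensor.\<close>

definition pure_tensor ::
    "'a::comm_ring_1 set \<Rightarrow> ('a, 'm, 'z) module_scheme \<Rightarrow> 'm list \<Rightarrow> ('m list \<Rightarrow>\<^sub>0 'a) set"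
  where "pure_tensor K M u = tensor_rels K M +>\<^bsub>word_module K M\<^esub> Poly_Mapping.single u 1"

definition tensor_module_pos ::
    "'a::comm_ring_1 set \<Rightarrow> ('a, 'm, 'z) module_scheme \<Rightarrow> ('a, ('m list \<Rightarrow>\<^sub>0 'a) set) module"
  where "tensor_module_pos K M = (tensor_module K M)\<lparr>carrier :=
    mod_span K (tensor_module K M) {pure_tensor K M u | u. u \<in> lists (carrier M) \<and> u \<noteq> []}\<rparr>"

definition prepend :: "'m \<Rightarrow> ('m list \<Rightarrow>\<^sub>0 'a::comm_ring_1) \<Rightarrow> ('m list \<Rightarrow>\<^sub>0 'a)"
  where "prepend x p =
    (\<Sum>w\<in>Poly_Mapping.keys p. Poly_Mapping.single (x # w) (Poly_Mapping.lookup p w))"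

fun shuffle_words :: "'m list \<Rightarrow> 'm list \<Rightarrow> ('m list \<Rightarrow>\<^sub>0 'a::comm_ring_1)"
  where
    "shuffle_words [] v = Poly_Mapping.single v 1"
  | "shuffle_words (x # u) [] = Poly_Mapping.single (x # u) 1"
  | "shuffle_words (x # u) (y # v) =
       prepend x (shuffle_words u (y # v)) + prepend y (shuffle_words (x # u) v)"

definition shuffle_free ::
    "('m list \<Rightarrow>\<^sub>0 'a::comm_ring_1) \<Rightarrow> ('m list \<Rightarrow>\<^sub>0 'a) \<Rightarrow> ('m list \<Rightarrow>\<^sub>0 'a)"
  where "shuffle_free p q = (\<Sum>u\<in>Poly_Mapping.keys p. \<Sum>v\<in>Poly_Mapping.keys q.
    fscale (Poly_Mapping.lookup p u * Poly_Mapping.lookup q v) (shuffle_words u v))"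

text \<open>
  Since \<^term>\<open>tensor_rels K M\<close> is absorbed by \<^const>\<open>shuffle_free\<close>, all cosets in the following
  union coincide.
\<close>

definition shuffle ::
    "'a::comm_ring_1 set \<Rightarrow> ('a, 'm, 'z) module_scheme \<Rightarrow>
     ('m list \<Rightarrow>\<^sub>0 'a) set \<Rightarrow> ('m list \<Rightarrow>\<^sub>0 'a) set \<Rightarrow> ('m list \<Rightarrow>\<^sub>0 'a) set"
  where "shuffle K M s t =
    (\<Union>p\<in>s. \<Union>q\<in>t. tensor_rels K M +>\<^bsub>word_module K M\<^esub> shuffle_free p q)"


section \<open>Symmetric squares and symmetric algebras\<close>

definition pair_module ::
    "'a::comm_ring_1 set \<Rightarrow> ('a, 'm, 'z) module_scheme \<Rightarrow> ('a, 'm \<times> 'm \<Rightarrow>\<^sub>0 'a) module"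
  where "pair_module K M = free_module K (carrier M \<times> carrier M)"

definition sym_square_rels ::
    "'a::comm_ring_1 set \<Rightarrow> ('a, 'm, 'z) module_scheme \<Rightarrow> ('m \<times> 'm \<Rightarrow>\<^sub>0 'a) set"
  where "sym_square_rels K M = mod_span K (pair_module K M)
    ({Poly_Mapping.single (x \<oplus>\<^bsub>M\<^esub> y, z) 1
        - Poly_Mapping.single (x, z) 1 - Poly_Mapping.single (y, z) 1 | x y z.
        x \<in> carrier M \<and> y \<in> carrier M \<and> z \<in> carrier M} \<union>
     {Poly_Mapping.single (z, x \<oplus>\<^bsub>M\<^esub> y) 1
        - Poly_Mapping.single (z, x) 1 - Poly_Mapping.single (z, y) 1 | x y z.
        x \<in> carrier M \<and> y \<in> carrier M \<and> z \<in> carrier M} \<union>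
     {Poly_Mapping.single (c \<odot>\<^bsub>M\<^esub> x, y) 1 - Poly_Mapping.single (x, y) c | c x y.
        c \<in> K \<and> x \<in> carrier M \<and> y \<in> carrier M} \<union>
     {Poly_Mapping.single (x, c \<odot>\<^bsub>M\<^esub> y) 1 - Poly_Mapping.single (x, y) c | c x y.
        c \<in> K \<and> x \<in> carrier M \<and> y \<in> carrier M} \<union>
     {Poly_Mapping.single (x, y) 1 - Poly_Mapping.single (y, x) 1 | x y.
        x \<in> carrier M \<and> y \<in> carrier M})"

definition sym_square ::
    "'a::comm_ring_1 set \<Rightarrow> ('a, 'm, 'z) module_scheme \<Rightarrow> ('a, ('m \<times> 'm \<Rightarrow>\<^sub>0 'a) set) module"
  where "sym_square K M = quot_module (pair_module K M) (sym_square_rels K M)"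

definition sym_prod ::
    "'a::comm_ring_1 set \<Rightarrow> ('a, 'm, 'z) module_scheme \<Rightarrow> 'm \<Rightarrow> 'm \<Rightarrow> ('m \<times> 'm \<Rightarrow>\<^sub>0 'a) set"
  where "sym_prod K M x y =
    sym_square_rels K M +>\<^bsub>pair_module K M\<^esub> Poly_Mapping.single (x, y) 1"

text \<open>
  Polynomials over \<open>K\<close> with one variable for each element of \<open>X\<close>: monomials are multisets
  over \<open>X\<close>, so multiplication is that of the monoid ring of the free commutative monoid.
\<close>

definition poly_ring :: "'a::comm_ring_1 set \<Rightarrow> 'x set \<Rightarrow> ('x multiset \<Rightarrow>\<^sub>0 'a) ring"
  where "poly_ring K X =
    \<lparr>carrier = {p. (\<forall>m\<in>Poly_Mapping.keys p. set_mset m \<subseteq> X) \<and> Poly_Mapping.range p \<subseteq> K},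
     mult = (*), one = 1, zero = 0, add = (+)\<rparr>"

definition sym_alg_rels ::
    "'a::comm_ring_1 set \<Rightarrow> ('a, 'm, 'z) module_scheme \<Rightarrow> ('m multiset \<Rightarrow>\<^sub>0 'a) set"
  where "sym_alg_rels K M = Idl\<^bsub>poly_ring K (carrier M)\<^esub>
    ({Poly_Mapping.single {#x \<oplus>\<^bsub>M\<^esub> y#} 1
        - Poly_Mapping.single {#x#} 1 - Poly_Mapping.single {#y#} 1 | x y.
        x \<in> carrier M \<and> y \<in> carrier M} \<union>
     {Poly_Mapping.single {#c \<odot>\<^bsub>M\<^esub> x#} 1 - Poly_Mapping.single {#x#} c | c x.
        c \<in> K \<and> x \<in> carrier M})"

definition sym_alg ::
    "'a::comm_ring_1 set \<Rightarrow> ('a, 'm, 'z) module_scheme \<Rightarrow> ('m multiset \<Rightarrow>\<^sub>0 'a) set ring"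
  where "sym_alg K M = poly_ring K (carrier M) Quot sym_alg_rels K M"

text \<open>The structure map of the algebra \<^term>\<open>sym_alg K M\<close> and the canonical map from \<open>M\<close> to it.\<close>

definition sym_const ::
    "'a::comm_ring_1 set \<Rightarrow> ('a, 'm, 'z) module_scheme \<Rightarrow> 'a \<Rightarrow> ('m multiset \<Rightarrow>\<^sub>0 'a) set"
  where "sym_const K M c =
    sym_alg_rels K M +>\<^bsub>poly_ring K (carrier M)\<^esub> Poly_Mapping.single {#} c"

definition sym_incl ::
    "'a::comm_ring_1 set \<Rightarrow> ('a, 'm, 'z) module_scheme \<Rightarrow> 'm \<Rightarrow> ('m multiset \<Rightarrow>\<^sub>0 'a) set"
  where "sym_incl K M x =
    sym_alg_rels K M +>\<^bsub>poly_ring K (carrier M)\<^esub> Poly_Mapping.single {#x#} 1"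


section \<open>The algebra \<open>C2\<close>\<close>

type_synonym ('a, 'm) tensor = "('m list \<Rightarrow>\<^sub>0 'a) set"
type_synonym ('a, 'm) sym2 = "(('a, 'm) tensor \<times> ('a, 'm) tensor \<Rightarrow>\<^sub>0 'a) set"
type_synonym ('a, 'm) sym_sym2 = "(('a, 'm) sym2 multiset \<Rightarrow>\<^sub>0 'a) set"

definition M2 ::
    "'a::comm_ring_1 set \<Rightarrow> ('a, 'm, 'z) module_scheme \<Rightarrow> ('a, ('a, 'm) sym2) module"
  where "M2 K M = sym_square K (tensor_module_pos K M)"

text \<open>
  The variables of the polynomial ring underlying the symmetric algebra are already a formal
  copy of \<^const>\<open>M2\<close>; \<open>eps K M s t\<close> is the element of the symmetric algebra given by the copy
  of the symmetric product of \<open>s\<close> and \<open>t\<close>.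
\<close>

definition eps ::
    "'a::comm_ring_1 set \<Rightarrow> ('a, 'm, 'z) module_scheme \<Rightarrow>
     ('a, 'm) tensor \<Rightarrow> ('a, 'm) tensor \<Rightarrow> ('a, 'm) sym_sym2"
  where "eps K M s t = sym_incl K (M2 K M) (sym_prod K (tensor_module_pos K M) s t)"

text \<open>
  For a word \<open>f\<close> of length \<open>n\<close>, the initial factor from 1 to \<open>i\<close> is \<^term>\<open>take i f\<close> and the final
  factor from \<open>i + 1\<close> to \<open>n\<close> is \<^term>\<open>drop i f\<close>. Subtraction on indices is truncated, so that
  \<open>1 - j\<close> is the maximum of \<open>0\<close> and \<open>1 - j\<close>.
\<close>

definition J2_generator ::
    "'a::comm_ring_1 set \<Rightarrow> ('a, 'm, 'z) module_scheme \<Rightarrow>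
     'm list \<Rightarrow> 'm list \<Rightarrow> 'm list \<Rightarrow> ('a, 'm) sym_sym2"
  where "J2_generator K M f g h =
    (let A = sym_alg K (M2 K M); P = pure_tensor K M; sh = shuffle K M; e = eps K M in
      (e (sh (P f) (P g)) (P h) \<ominus>\<^bsub>A\<^esub> e (P f) (sh (P g) (P h))) \<oplus>\<^bsub>A\<^esub>
      (\<Oplus>\<^bsub>A\<^esub> j\<in>{0..<length g}.
        (\<Oplus>\<^bsub>A\<^esub> i\<in>{1 - j..<length f}.
           e (P (drop i f)) (P (drop j g)) \<otimes>\<^bsub>A\<^esub> e (sh (P (take i f)) (P (take j g))) (P h)) \<ominus>\<^bsub>A\<^esub>
        (\<Oplus>\<^bsub>A\<^esub> k\<in>{1 - j..<length h}.
           e (P f) (sh (P (take j g)) (P (take k h))) \<otimes>\<^bsub>A\<^esub> e (P (drop j g)) (P (drop k h)))))"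

definition J2 ::
    "'a::comm_ring_1 set \<Rightarrow> ('a, 'm, 'z) module_scheme \<Rightarrow> ('a, 'm) sym_sym2 set"
  where "J2 K M = Idl\<^bsub>sym_alg K (M2 K M)\<^esub>
    {J2_generator K M f g h | f g h.
       f \<in> lists (carrier M) \<and> g \<in> lists (carrier M) \<and> h \<in> lists (carrier M) \<and>
       f \<noteq> [] \<and> g \<noteq> [] \<and> h \<noteq> []}"

definition C2 ::
    "'a::comm_ring_1 set \<Rightarrow> ('a, 'm, 'z) module_scheme \<Rightarrow> ('a, 'm) sym_sym2 set ring"
  where "C2 K M = sym_alg K (M2 K M) Quot J2 K M"

definition C2_const ::
    "'a::comm_ring_1 set \<Rightarrow> ('a, 'm, 'z) module_scheme \<Rightarrow> 'a \<Rightarrow> ('a, 'm) sym_sym2 set"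
  where "C2_const K M c = J2 K M +>\<^bsub>sym_alg K (M2 K M)\<^esub> sym_const K (M2 K M) c"

definition C2_elem ::
    "'a::comm_ring_1 set \<Rightarrow> ('a, 'm, 'z) module_scheme \<Rightarrow> ('i \<Rightarrow> 'm) \<Rightarrow> 'i list \<Rightarrow> 'i list \<Rightarrow>
     ('a, 'm) sym_sym2 set"
  where "C2_elem K M a V W = J2 K M +>\<^bsub>sym_alg K (M2 K M)\<^esub>
    eps K M (pure_tensor K M (map a V)) (pure_tensor K M (map a W))"

text \<open>Generation as an algebra over \<open>K\<close>, where \<open>\<eta>\<close> is the structure map from \<open>K\<close> to \<open>A\<close>.\<close>

definition generates_algebra :: "'a set \<Rightarrow> ('a \<Rightarrow> 'b) \<Rightarrow> 'b ring \<Rightarrow> 'b set \<Rightarrow> bool"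
  where "generates_algebra K \<eta> A X \<longleftrightarrow> generate_ring A (\<eta> ` K \<union> X) = carrier A"


section \<open>Words\<close>

definition lex_less :: "'i::linorder list \<Rightarrow> 'i list \<Rightarrow> bool"
  where "lex_less V W \<longleftrightarrow> (V, W) \<in> lexord {(x, y). x < y}"

definition dlex_less :: "'i::linorder list \<Rightarrow> 'i list \<Rightarrow> bool"
  where "dlex_less V W \<longleftrightarrow> (V, W) \<in> lenlex {(x, y). x < y}"

definition lyndon :: "'i::linorder list \<Rightarrow> bool"
  where "lyndon V \<longleftrightarrow> V \<noteq> [] \<and> (\<forall>U. U \<noteq> [] \<and> strict_suffix U V \<longrightarrow> lex_less V U)"

definition is_max_shuffle :: "'i::linorder list \<Rightarrow> 'i list \<Rightarrow> 'i list \<Rightarrow> bool"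
  where "is_max_shuffle U V W \<longleftrightarrow>
    U \<in> shuffles V W \<and> (\<forall>U'\<in>shuffles V W. U' = U \<or> lex_less U' U)"

definition index_pairs :: "'i::linorder set \<Rightarrow> ('i list \<times> 'i list) set"
  where "index_pairs I = {(V, W).
    V \<in> lists I \<and> V \<noteq> [] \<and> W \<in> lists I \<and> W \<noteq> [] \<and>
    (V = W \<or> dlex_less V W) \<and> lyndon V \<and>
    \<not> (\<exists>W1 W2. W1 \<in> lists I \<and> W1 \<noteq> [] \<and> W2 \<in> lists I \<and> W2 \<noteq> [] \<and>
         dlex_less W1 V \<and> is_max_shuffle W W1 W2)}"


section \<open>Well-definedness of the constructions\<close>

lemma cring_subring_ofD:
  assumes "cring (subring_of K)"
  shows "0 \<in> K" "1 \<in> K" "x \<in> K \<Longrightarrow> y \<in> K \<Longrightarrow> x + y \<in> K"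
    "x \<in> K \<Longrightarrow> y \<in> K \<Longrightarrow> x * y \<in> K" "x \<in> K \<Longrightarrow> - x \<in> K"
proof -
  interpret cring "subring_of K" by fact
  show "0 \<in> K" "1 \<in> K" "x \<in> K \<Longrightarrow> y \<in> K \<Longrightarrow> x + y \<in> K"
    "x \<in> K \<Longrightarrow> y \<in> K \<Longrightarrow> x * y \<in> K"
    using zero_closed one_closed a_closed[of x y] m_closed[of x y] by (auto simp: subring_of_def)
  assume "x \<in> K"
  then obtain y where "y \<in> K" "x + y = 0"
    using add.r_inv_ex[of x] by (auto simp: subring_of_def)
  moreover from \<open>x + y = 0\<close> have "y = - x" by (simp add: eq_neg_iff_add_eq_0 add.commute)
  ultimately show "- x \<in> K" by simp
qed

lemma cring_subring_ofI:
  assumes "0 \<in> K" "1 \<in> K" "\<And>x y. x \<in> K \<Longrightarrow> y \<in> K \<Longrightarrow> x + y \<in> K"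
    "\<And>x y. x \<in> K \<Longrightarrow> y \<in> K \<Longrightarrow> x * y \<in> K" "\<And>x. x \<in> K \<Longrightarrow> - x \<in> K"
  shows "cring (subring_of K)"
proof (intro cringI abelian_groupI comm_monoidI)
  fix x assume "x \<in> carrier (subring_of K)"
  then show "\<exists>y\<in>carrier (subring_of K). y \<oplus>\<^bsub>subring_of K\<^esub> x = \<zero>\<^bsub>subring_of K\<^esub>"
    using assms(5)[of x] by (auto simp: subring_of_def intro!: bexI[of _ "- x"])
qed (use assms in \<open>auto simp: subring_of_def algebra_simps\<close>)

lemma (in differential_ring) cring_constants: "cring (subring_of (constants d))"
proof -
  have d0: "d 0 = 0" using d_add[of 0 0] by simp
  moreover have "d 1 = 0" using d_mult[of 1 1] by simp
  moreover have "d (- x) = - d x" for x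
    using d_add[of x "- x"] d0 by (simp add: eq_neg_iff_add_eq_0 add.commute)
  ultimately show ?thesis
    by (intro cring_subring_ofI) (auto simp: constants_def d_add d_mult)
qed

lemma (in quasi_integration) module_kernel: "module (subring_of (constants d)) (kernel_module Q)"
proof -
  have q0: "Q 0 = 0" using Q_add[of 0 0] by simp
  have qm: "Q (- x) = - Q x" for x
    using Q_add[of x "- x"] q0 by (simp add: eq_neg_iff_add_eq_0 add.commute)
  show ?thesis
  proof (intro moduleI cring_constants abelian_groupI)
    fix x assume "x \<in> carrier (kernel_module Q)"
    then show "\<exists>y\<in>carrier (kernel_module Q). y \<oplus>\<^bsub>kernel_module Q\<^esub> x = \<zero>\<^bsub>kernel_module Q\<^esub>"
      using qm[of x] by (auto simp: kernel_module_def regular_module_def intro!: bexI[of _ "- x"])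
  qed (auto simp: kernel_module_def regular_module_def subring_of_def Q_add Q_scale q0 algebra_simps)
qed

lemma lookup_fscale [simp]: "Poly_Mapping.lookup (fscale c p) x = c * Poly_Mapping.lookup p x"
  unfolding fscale_def by transfer (auto simp: when_def)

lemma range_subset_iff:
  "0 \<in> K \<Longrightarrow> Poly_Mapping.range p \<subseteq> K \<longleftrightarrow> (\<forall>x. Poly_Mapping.lookup p x \<in> K)"
  by (auto simp: range.rep_eq subset_iff) (metis UNIV_I image_eqI)

lemma carrier_free_module:
  "0 \<in> K \<Longrightarrow> carrier (free_module K X) = {p. (\<forall>x. Poly_Mapping.lookup p x \<in> K \<and>
     (Poly_Mapping.lookup p x \<noteq> 0 \<longrightarrow> x \<in> X))}"
  by (auto simp: free_module_def range_subset_iff in_keys_iff)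

lemma module_free:
  assumes K: "cring (subring_of K)"
  shows "module (subring_of K) (free_module K X)"
proof -
  note k = cring_subring_ofD[OF K]
  have sel: "add (free_module K X) = (+)" "zero (free_module K X) = 0"
    "smult (free_module K X) = fscale" by (auto simp: free_module_def)
  have cK: "carrier (subring_of K) = K" "mult (subring_of K) = (*)" "add (subring_of K) = (+)"
     "one (subring_of K) = 1"
    by (auto simp: subring_of_def)
  show ?thesis
  proof (intro moduleI K abelian_groupI; (unfold sel cK)?)
    fix x assume x: "x \<in> carrier (free_module K X)"
    then show "\<exists>y\<in>carrier (free_module K X). y + x = 0"
      using k by (intro bexI[of _ "- x"]) (auto simp: carrier_free_module[OF k(1)])
  next
    fix x y assume "x \<in> carrier (free_module K X)" "y \<in> carrier (free_module K X)"
    then show "x + y \<in> carrier (free_module K X)"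
      using k(3) by (simp add: carrier_free_module[OF k(1)] lookup_add) (metis add.right_neutral)
  next
    fix c x assume "c \<in> K" "x \<in> carrier (free_module K X)"
    then show "fscale c x \<in> carrier (free_module K X)"
      using k by (auto simp: carrier_free_module[OF k(1)]) (metis mult_zero_right)
  qed (auto simp: carrier_free_module[OF k(1)] k lookup_add algebra_simps intro!: poly_mapping_eqI)
qed

lemma submodule_mod_span:
  assumes "module (subring_of K) M" "X \<subseteq> carrier M"
  shows "submodule (mod_span K M X) (subring_of K) M"
proof -
  interpret module "subring_of K" M by fact
  note E = submoduleE[unfolded subset_iff]
  have *: "submodule (carrier M) (subring_of K) M" by (rule carrier_is_submodule)
  have z: "\<zero>\<^bsub>M\<^esub> \<in> N" if "submodule N (subring_of K) M" for N
    using submodule.axioms(1)[OF that] subgroup.one_closed by fastforce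
  show ?thesis
    unfolding mod_span_def
    by (rule submoduleI) (use * assms(2) z submoduleE in \<open>auto 4 4\<close>)
qed

lemma mod_span_incl: "X \<subseteq> mod_span K M X"
  by (auto simp: mod_span_def)


context
  fixes R :: "('a, 'r) ring_scheme" and M :: "('a, 'm, 'z) module_scheme" and N
  assumes M: "module R M" and N: "submodule N R M"
begin

interpretation module R M by (rule M)

lemma abelian_subgroup_submodule: "abelian_subgroup N M"
  using N abelian_group_axioms
  by (intro abelian_subgroupI3 additive_subgroup.intro) (auto simp: submodule_def)

interpretation abelian_subgroup N M by (rule abelian_subgroup_submodule)

lemma carrier_quot_module: "carrier (quot_module M N) = {N +>\<^bsub>M\<^esub> x | x. x \<in> carrier M}"
  by (auto simp: quot_module_def A_RCOSETS_def')

lemma quot_module_add: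
  "x \<in> carrier M \<Longrightarrow> y \<in> carrier M \<Longrightarrow>
    (N +>\<^bsub>M\<^esub> x) \<oplus>\<^bsub>quot_module M N\<^esub> (N +>\<^bsub>M\<^esub> y) = N +>\<^bsub>M\<^esub> (x \<oplus>\<^bsub>M\<^esub> y)"
  by (simp add: quot_module_def a_rcos_sum)

lemma quot_module_smult:
  assumes "c \<in> carrier R" "x \<in> carrier M"
  shows "c \<odot>\<^bsub>quot_module M N\<^esub> (N +>\<^bsub>M\<^esub> x) = N +>\<^bsub>M\<^esub> (c \<odot>\<^bsub>M\<^esub> x)"
proof -
  have "N +>\<^bsub>M\<^esub> (c \<odot>\<^bsub>M\<^esub> y) = N +>\<^bsub>M\<^esub> (c \<odot>\<^bsub>M\<^esub> x)" if "y \<in> N +>\<^bsub>M\<^esub> x" for y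
  proof -
    from that obtain n where n: "n \<in> N" "y = n \<oplus>\<^bsub>M\<^esub> x" by (auto simp: a_r_coset_def')
    then have "c \<odot>\<^bsub>M\<^esub> y = c \<odot>\<^bsub>M\<^esub> n \<oplus>\<^bsub>M\<^esub> c \<odot>\<^bsub>M\<^esub> x"
      using assms a_Hcarr by (auto simp: smult_r_distr)
    moreover have "c \<odot>\<^bsub>M\<^esub> n \<in> N" using submodule.smult_closed[OF N assms(1) n(1)] .
    ultimately have "c \<odot>\<^bsub>M\<^esub> y \<in> N +>\<^bsub>M\<^esub> (c \<odot>\<^bsub>M\<^esub> x)" by (auto simp: a_r_coset_def')
    then show ?thesis by (rule a_repr_independence'[symmetric]) (use assms in auto)
  qed
  moreover have "x \<in> N +>\<^bsub>M\<^esub> x" using assms a_rcos_self by auto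
  ultimately have "(\<Union>y\<in>N +>\<^bsub>M\<^esub> x. N +>\<^bsub>M\<^esub> (c \<odot>\<^bsub>M\<^esub> y)) = N +>\<^bsub>M\<^esub> (c \<odot>\<^bsub>M\<^esub> x)" by blast
  then show ?thesis by (simp add: quot_module_def)
qed

lemma module_quot: "module R (quot_module M N)"
proof (intro moduleI abelian_groupI)
  show "cring R" ..
  have z: "\<zero>\<^bsub>quot_module M N\<^esub> = N +>\<^bsub>M\<^esub> \<zero>\<^bsub>M\<^esub>"
    by (simp add: quot_module_def a_coset_add_zero[OF a_subset])
  then show "\<zero>\<^bsub>quot_module M N\<^esub> \<in> carrier (quot_module M N)" by (auto simp: carrier_quot_module)
  fix x assume "x \<in> carrier (quot_module M N)"
  then obtain x' where x: "x' \<in> carrier M" "x = N +>\<^bsub>M\<^esub> x'" by (auto simp: carrier_quot_module)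
  then show "\<zero>\<^bsub>quot_module M N\<^esub> \<oplus>\<^bsub>quot_module M N\<^esub> x = x"
    by (simp add: z quot_module_add)
  show "\<exists>y\<in>carrier (quot_module M N). y \<oplus>\<^bsub>quot_module M N\<^esub> x = \<zero>\<^bsub>quot_module M N\<^esub>"
    using x by (intro bexI[of _ "N +>\<^bsub>M\<^esub> (\<ominus>\<^bsub>M\<^esub> x')"])
      (auto simp: z quot_module_add carrier_quot_module M.l_neg)
qed (auto simp: carrier_quot_module quot_module_add quot_module_smult smult_l_distr smult_r_distr
       smult_assoc1 M.a_ac intro: exI)
end

lemma cring_poly_ring:
  assumes K: "cring (subring_of K)"
  shows "cring (poly_ring K X)"
proof -
  note k = cring_subring_ofD[OF K]
  have car: "carrier (poly_ring K X) = {p. \<forall>m. Poly_Mapping.lookup p m \<in> K \<and>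
     (Poly_Mapping.lookup p m \<noteq> 0 \<longrightarrow> set_mset m \<subseteq> X)}"
    by (auto simp: poly_ring_def range_subset_iff[OF k(1)] in_keys_iff)
  have sel: "add (poly_ring K X) = (+)" "zero (poly_ring K X) = 0"
    "mult (poly_ring K X) = (*)" "one (poly_ring K X) = 1" by (auto simp: poly_ring_def)
  have sumK: "sum f A \<in> K" if "\<And>x. x \<in> A \<Longrightarrow> f x \<in> K" for f and A :: "'b multiset set"
    using that by (induction A rule: infinite_finite_induct) (auto simp: k)
  show ?thesis
  proof (intro cringI abelian_groupI comm_monoidI; (unfold sel)?)
    fix p assume p: "p \<in> carrier (poly_ring K X)"
    then show "\<exists>q\<in>carrier (poly_ring K X). q + p = 0"
      using k by (intro bexI[of _ "- p"]) (auto simp: car)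
  next
    fix p q assume p: "p \<in> carrier (poly_ring K X)" "q \<in> carrier (poly_ring K X)"
    then show "p + q \<in> carrier (poly_ring K X)"
      using k(3) by (simp add: car lookup_add) (metis add.right_neutral)
    have "set_mset m \<subseteq> X" if "m \<in> Poly_Mapping.keys (p * q)" for m
    proof -
      from that obtain a b where "m = a + b" "a \<in> Poly_Mapping.keys p" "b \<in> Poly_Mapping.keys q"
        using keys_mult[of p q] by auto
      then show ?thesis using p by (auto simp: poly_ring_def)
    qed
    moreover have "Poly_Mapping.lookup (p * q) m \<in> K" for m
    proof -
      have "prod_fun (Poly_Mapping.lookup p) (Poly_Mapping.lookup q) m \<in> K"
        unfolding prod_fun_def Sum_any.expand_set
        using p by (intro sumK k) (auto simp: car when_def k)
      then show ?thesis by (simp add: lookup_mult prod_fun_def)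
    qed
    ultimately show "p * q \<in> carrier (poly_ring K X)"
      by (auto simp: car in_keys_iff)
  qed (auto simp: car k lookup_one when_def algebra_simps)
qed

lemma cring_sym_alg:
  assumes K: "cring (subring_of K)" and M: "module (subring_of K) M"
  shows "ideal (sym_alg_rels K M) (poly_ring K (carrier M))" "cring (sym_alg K M)"
proof -
  note k = cring_subring_ofD[OF K]
  interpret P: cring "poly_ring K (carrier M)" by (rule cring_poly_ring[OF K])
  interpret M: module "subring_of K" M by (rule M)
  have sing: "Poly_Mapping.single {#x#} c \<in> carrier (poly_ring K (carrier M))"
    if "c \<in> K" "x \<in> carrier M" for c x
    using that k by (auto simp: poly_ring_def range_subset_iff[OF k(1)] lookup_single when_def split: if_splits)
  have diff: "p - q \<in> carrier (poly_ring K (carrier M))"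
    if "p \<in> carrier (poly_ring K (carrier M))" "q \<in> carrier (poly_ring K (carrier M))" for p q
  proof -
    have "\<ominus>\<^bsub>poly_ring K (carrier M)\<^esub> q = - q"
      by (rule P.minus_equality) (use that k in \<open>auto simp: poly_ring_def range_subset_iff[OF k(1)] in_keys_iff\<close>)
    then show ?thesis using P.minus_closed[OF that] by (simp add: a_minus_def poly_ring_def)
  qed
  have "x \<in> K \<Longrightarrow> y \<in> carrier M \<Longrightarrow> x \<odot>\<^bsub>M\<^esub> y \<in> carrier M" for x y
    using M.smult_closed[of x y] by (simp add: subring_of_def)
  then show *: "ideal (sym_alg_rels K M) (poly_ring K (carrier M))"
    unfolding sym_alg_rels_def
    by (intro P.genideal_ideal) (auto intro!: diff sing k)
  show "cring (sym_alg K M)"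
    unfolding sym_alg_def by (rule ideal.quotient_is_cring[OF * P.is_cring])
qed

lemma lookup_prepend:
  "Poly_Mapping.lookup (prepend x p) w =
    (case w of [] \<Rightarrow> 0 | y # w' \<Rightarrow> if y = x then Poly_Mapping.lookup p w' else 0)"
proof -
  have "Poly_Mapping.lookup (prepend x p) (y # w') = (if y = x then Poly_Mapping.lookup p w' else 0)" for y w'
  proof (cases "y = x \<and> w' \<in> Poly_Mapping.keys p")
    case True
    then show ?thesis
      by (simp add: prepend_def lookup_sum lookup_single when_def sum.delta' if_distrib cong: if_cong)
  qed (auto simp: prepend_def lookup_sum lookup_single when_def in_keys_iff intro!: sum.neutral)
  moreover have "Poly_Mapping.lookup (prepend x p) [] = 0"
    by (auto simp: prepend_def lookup_sum lookup_single when_def)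
  ultimately show ?thesis by (auto split: list.split)
qed

lemma prepend_linear:
  "prepend x (p + q) = prepend x p + prepend x q"
  "prepend x (p - q) = prepend x p - prepend x q"
  "prepend x (- p) = - prepend x p"
  "prepend x (fscale c p) = fscale c (prepend x p)"
  "prepend x (Poly_Mapping.single w b) = Poly_Mapping.single (x # w) b"
  "prepend x 0 = 0"
  by (rule poly_mapping_eqI; auto simp: lookup_prepend lookup_add lookup_minus lookup_single when_def split: list.split)+


lemma shuffle_words_Nil2 [simp]: "shuffle_words u [] = Poly_Mapping.single u 1"
  by (cases u) auto

lemma shuffle_words_commute: "shuffle_words u v = shuffle_words v u"
  by (induction u v rule: shuffle_words.induct) (auto simp: add.commute)

lemma fscale_simps:
  "fscale c (p + q) = fscale c p + fscale c q" "fscale (b + c) p = fscale b p + fscale c p"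
  "fscale c (p - q) = fscale c p - fscale c q"
  "fscale b (fscale c p) = fscale (b * c) p" "fscale 0 p = 0" "fscale c 0 = 0"
  "fscale 1 p = p" "fscale c (Poly_Mapping.single w b) = Poly_Mapping.single w (c * b)"
  "fscale c (- p) = - fscale c p"
  by (rule poly_mapping_eqI; simp add: lookup_add lookup_minus lookup_single when_def algebra_simps)+

lemma fscale_sum: "fscale c (sum f A) = (\<Sum>x\<in>A. fscale c (f x))"
  by (induction A rule: infinite_finite_induct) (auto simp: fscale_simps)

lemma shuffle_free_superset:
  assumes "finite A" "finite B" "Poly_Mapping.keys p \<subseteq> A" "Poly_Mapping.keys q \<subseteq> B"
  shows "shuffle_free p q = (\<Sum>u\<in>A. \<Sum>v\<in>B.
    fscale (Poly_Mapping.lookup p u * Poly_Mapping.lookup q v) (shuffle_words u v))"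
proof -
  have "(\<Sum>v\<in>B. fscale (Poly_Mapping.lookup p u * Poly_Mapping.lookup q v) (shuffle_words u v)) =
    (\<Sum>v\<in>Poly_Mapping.keys q. fscale (Poly_Mapping.lookup p u * Poly_Mapping.lookup q v) (shuffle_words u v))" for u
    by (rule sum.mono_neutral_right) (use assms in \<open>auto simp: in_keys_iff fscale_simps\<close>)
  then show ?thesis unfolding shuffle_free_def
    by (simp, intro sum.mono_neutral_left) (use assms in \<open>auto simp: in_keys_iff fscale_simps\<close>)
qed

lemma shuffle_free_commute: "shuffle_free p q = shuffle_free q p"
  unfolding shuffle_free_def
  by (subst sum.swap) (simp add: mult.commute shuffle_words_commute)

lemma shuffle_free_add: "shuffle_free (p + p') q = shuffle_free p q + shuffle_free p' q"
proof -
  let ?A = "Poly_Mapping.keys p \<union> Poly_Mapping.keys p'"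
  show ?thesis
    using shuffle_free_superset[of ?A "Poly_Mapping.keys q" "p + p'" q] Poly_Mapping.keys_add[of p p']
      shuffle_free_superset[of ?A "Poly_Mapping.keys q" p q] shuffle_free_superset[of ?A "Poly_Mapping.keys q" p' q]
    by (simp add: lookup_add fscale_simps distrib_right sum.distrib)
qed

lemma shuffle_free_scale: "shuffle_free (fscale c p) q = fscale c (shuffle_free p q)"
proof -
  have "Poly_Mapping.keys (fscale c p) \<subseteq> Poly_Mapping.keys p" by (auto simp: in_keys_iff)
  then show ?thesis
    using shuffle_free_superset[of "Poly_Mapping.keys p" "Poly_Mapping.keys q" "fscale c p" q]
    by (simp add: shuffle_free_def fscale_sum fscale_simps mult.assoc)
qed

lemma shuffle_free_single:
  "shuffle_free (Poly_Mapping.single u 1) (Poly_Mapping.single v 1) = (shuffle_words u v :: _ \<Rightarrow>\<^sub>0 'a::comm_ring_1)"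
  by (simp add: shuffle_free_def fscale_simps)

lemma shuffle_free_minus: "shuffle_free (- p) q = - shuffle_free p q"
  using shuffle_free_scale[of "-1" p q]
  by (simp add: poly_mapping_eq_iff fun_eq_iff)
     (metis (no_types) add.inverse_inverse fscale_simps(7,9) lookup_fscale mult_minus1 poly_mapping_eqI lookup_uminus)

lemma shuffle_free_diff: "shuffle_free (p - p') q = shuffle_free p q - shuffle_free p' q"
  using shuffle_free_add[of p "- p'" q] by (simp add: shuffle_free_minus)

context
  fixes K :: "'a::comm_ring_1 set" and M :: "('a, 'm, 'z) module_scheme"
  assumes K: "cring (subring_of K)" and M: "module (subring_of K) M"
begin

private abbreviation (input) F where "F \<equiv> word_module K M"
private abbreviation (input) N where "N \<equiv> tensor_rels K M"
private abbreviation (input) L where "L \<equiv> lists (carrier M)"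

lemma F_sel: "add F = (+)" "zero F = 0" "smult F = fscale"
  by (auto simp: word_module_def free_module_def)

lemma carrier_F: "p \<in> carrier F \<longleftrightarrow> (\<forall>w. Poly_Mapping.lookup p w \<in> K \<and> (Poly_Mapping.lookup p w \<noteq> 0 \<longrightarrow> w \<in> L))"
  by (auto simp: word_module_def carrier_free_module[OF cring_subring_ofD(1)[OF K]])

lemma module_F: "module (subring_of K) F"
  unfolding word_module_def by (rule module_free[OF K])

lemma minus_F: "p \<in> carrier F \<Longrightarrow> \<ominus>\<^bsub>F\<^esub> p = - p"
proof -
  interpret module "subring_of K" F by (rule module_F)
  assume p: "p \<in> carrier F"
  then have "- p \<in> carrier F" using cring_subring_ofD[OF K] by (auto simp: carrier_F)
  then show ?thesis using p by (intro minus_equality) (auto simp: F_sel)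
qed

lemma submodule_FI:
  assumes "S \<subseteq> carrier F" "0 \<in> S" "\<And>p q. p \<in> S \<Longrightarrow> q \<in> S \<Longrightarrow> p + q \<in> S"
    "\<And>c p. c \<in> K \<Longrightarrow> p \<in> S \<Longrightarrow> fscale c p \<in> S"
  shows "submodule S (subring_of K) F"
proof -
  interpret module "subring_of K" F by (rule module_F)
  have "- p \<in> S" if "p \<in> S" for p
    using assms(4)[OF cring_subring_ofD(5)[OF K cring_subring_ofD(2)[OF K]] that]
    by (metis fscale_simps(7) fscale_simps(5) add.right_inverse fscale_simps(2) add_eq_0_iff)
  then show ?thesis
    by (intro submoduleI) (use assms minus_F in \<open>auto simp: F_sel subring_of_def\<close>)
qed

lemma submodule_FD:
  assumes "submodule S (subring_of K) F"
  shows "S \<subseteq> carrier F" "0 \<in> S" "p \<in> S \<Longrightarrow> q \<in> S \<Longrightarrow> p + q \<in> S"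
    "c \<in> K \<Longrightarrow> p \<in> S \<Longrightarrow> fscale c p \<in> S" "p \<in> S \<Longrightarrow> - p \<in> S" "p \<in> S \<Longrightarrow> q \<in> S \<Longrightarrow> p - q \<in> S"
proof -
  interpret module "subring_of K" F by (rule module_F)
  note E = submoduleE[OF assms]
  show 1: "S \<subseteq> carrier F" by (rule E)
  show *: "p \<in> S \<Longrightarrow> q \<in> S \<Longrightarrow> p + q \<in> S" for p q using E(5)[of p q] by (simp add: F_sel)
  show "c \<in> K \<Longrightarrow> p \<in> S \<Longrightarrow> fscale c p \<in> S" using E(4)[of c p] by (simp add: F_sel subring_of_def)
  show **: "p \<in> S \<Longrightarrow> - p \<in> S" for p using E(3)[of p] minus_F 1 by auto
  show "p \<in> S \<Longrightarrow> q \<in> S \<Longrightarrow> p - q \<in> S" using *[of p "- q"] **[of q] by simp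
  obtain p where "p \<in> S" using E(2) by blast
  then show "0 \<in> S" using *[of p "- p"] **[of p] by simp
qed

lemma carrier_F_sub:
  "p \<in> carrier F \<Longrightarrow> q \<in> carrier F \<Longrightarrow> p + q \<in> carrier F"
  "p \<in> carrier F \<Longrightarrow> q \<in> carrier F \<Longrightarrow> p - q \<in> carrier F"
  "c \<in> K \<Longrightarrow> p \<in> carrier F \<Longrightarrow> fscale c p \<in> carrier F"
  "0 \<in> carrier F"
  by (rule submodule_FD(3,6,4,2)[OF module.carrier_is_submodule[OF module_F]]; assumption)+

lemma F_induct:
  assumes S: "submodule S (subring_of K) F" and 1: "\<And>w. w \<in> L \<Longrightarrow> Poly_Mapping.single w 1 \<in> S"
    and p: "p \<in> carrier F"
  shows "p \<in> S"
proof -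
  have "(\<Sum>w\<in>A. fscale (Poly_Mapping.lookup p w) (Poly_Mapping.single w 1)) \<in> S"
    if "A \<subseteq> Poly_Mapping.keys p" for A
    using finite_subset[OF that finite_keys] that
  proof (induction A rule: finite_induct)
    case (insert w A)
    then have "fscale (Poly_Mapping.lookup p w) (Poly_Mapping.single w 1) \<in> S"
      using p by (intro submodule_FD[OF S] 1) (auto simp: carrier_F in_keys_iff)
    then show ?case using insert by (auto intro: submodule_FD[OF S])
  qed (auto intro: submodule_FD[OF S])
  moreover have "(\<Sum>w\<in>Poly_Mapping.keys p. fscale (Poly_Mapping.lookup p w) (Poly_Mapping.single w 1)) = p"
    by (rule poly_mapping_eqI) (auto simp: fscale_simps lookup_sum lookup_single when_def in_keys_iff)
  ultimately show ?thesis by (metis order_refl)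
qed

lemma single_in_F: "w \<in> L \<Longrightarrow> c \<in> K \<Longrightarrow> Poly_Mapping.single w c \<in> carrier F"
  using cring_subring_ofD(1)[OF K] by (auto simp: carrier_F lookup_single when_def split: if_splits)

lemma M_closed: "x \<in> carrier M \<Longrightarrow> y \<in> carrier M \<Longrightarrow> x \<oplus>\<^bsub>M\<^esub> y \<in> carrier M"
  "c \<in> K \<Longrightarrow> y \<in> carrier M \<Longrightarrow> c \<odot>\<^bsub>M\<^esub> y \<in> carrier M"
proof -
  interpret module "subring_of K" M by (rule M)
  show "x \<in> carrier M \<Longrightarrow> y \<in> carrier M \<Longrightarrow> x \<oplus>\<^bsub>M\<^esub> y \<in> carrier M" by simp
  show "c \<in> K \<Longrightarrow> y \<in> carrier M \<Longrightarrow> c \<odot>\<^bsub>M\<^esub> y \<in> carrier M"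
    using smult_closed[of c y] by (simp add: subring_of_def)
qed

lemma tensor_rels:
  shows submodule_N: "submodule N (subring_of K) F"
    and gen_add: "u \<in> L \<Longrightarrow> v \<in> L \<Longrightarrow> x \<in> carrier M \<Longrightarrow> y \<in> carrier M \<Longrightarrow>
      Poly_Mapping.single (u @ (x \<oplus>\<^bsub>M\<^esub> y) # v) 1
        - Poly_Mapping.single (u @ x # v) 1 - Poly_Mapping.single (u @ y # v) 1 \<in> N"
    and gen_smult: "u \<in> L \<Longrightarrow> v \<in> L \<Longrightarrow> c \<in> K \<Longrightarrow> x \<in> carrier M \<Longrightarrow>
      Poly_Mapping.single (u @ (c \<odot>\<^bsub>M\<^esub> x) # v) 1 - Poly_Mapping.single (u @ x # v) c \<in> N"
    and N_induct: "\<And>S p. submodule S (subring_of K) F \<Longrightarrow> p \<in> N \<Longrightarrow>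
      (\<And>u v x y. u \<in> L \<Longrightarrow> v \<in> L \<Longrightarrow> x \<in> carrier M \<Longrightarrow> y \<in> carrier M \<Longrightarrow>
        Poly_Mapping.single (u @ (x \<oplus>\<^bsub>M\<^esub> y) # v) 1
        - Poly_Mapping.single (u @ x # v) 1 - Poly_Mapping.single (u @ y # v) 1 \<in> S) \<Longrightarrow>
      (\<And>u v c x. u \<in> L \<Longrightarrow> v \<in> L \<Longrightarrow> c \<in> K \<Longrightarrow> x \<in> carrier M \<Longrightarrow>
        Poly_Mapping.single (u @ (c \<odot>\<^bsub>M\<^esub> x) # v) 1 - Poly_Mapping.single (u @ x # v) c \<in> S) \<Longrightarrow> p \<in> S"
proof -
  let ?G1 = "{Poly_Mapping.single (u @ (x \<oplus>\<^bsub>M\<^esub> y) # v) 1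
        - Poly_Mapping.single (u @ x # v) 1 - Poly_Mapping.single (u @ y # v) (1::'a) | u v x y.
        u \<in> L \<and> v \<in> L \<and> x \<in> carrier M \<and> y \<in> carrier M}"
  let ?G2 = "{Poly_Mapping.single (u @ (c \<odot>\<^bsub>M\<^esub> x) # v) 1 - Poly_Mapping.single (u @ x # v) c | u v c x.
        u \<in> L \<and> v \<in> L \<and> c \<in> K \<and> x \<in> carrier M}"
  have eq: "N = mod_span K F (?G1 \<union> ?G2)" by (simp add: tensor_rels_def)
  have "?G1 \<union> ?G2 \<subseteq> carrier F"
    by (auto intro!: carrier_F_sub single_in_F M_closed cring_subring_ofD(2)[OF K])
  then show "submodule N (subring_of K) F"
    unfolding eq by (rule submodule_mod_span[OF module_F])
  have incl: "?G1 \<union> ?G2 \<subseteq> N" unfolding eq by (rule mod_span_incl)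
  show "u \<in> L \<Longrightarrow> v \<in> L \<Longrightarrow> x \<in> carrier M \<Longrightarrow> y \<in> carrier M \<Longrightarrow>
      Poly_Mapping.single (u @ (x \<oplus>\<^bsub>M\<^esub> y) # v) 1
        - Poly_Mapping.single (u @ x # v) 1 - Poly_Mapping.single (u @ y # v) 1 \<in> N"
    by (rule subsetD[OF incl], rule UnI1) blast
  show "u \<in> L \<Longrightarrow> v \<in> L \<Longrightarrow> c \<in> K \<Longrightarrow> x \<in> carrier M \<Longrightarrow>
      Poly_Mapping.single (u @ (c \<odot>\<^bsub>M\<^esub> x) # v) 1 - Poly_Mapping.single (u @ x # v) c \<in> N"
    by (rule subsetD[OF incl], rule UnI2) blast
  fix S p
  assume S: "submodule S (subring_of K) F" "p \<in> N"
    and "\<And>u v x y. u \<in> L \<Longrightarrow> v \<in> L \<Longrightarrow> x \<in> carrier M \<Longrightarrow> y \<in> carrier M \<Longrightarrow>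
        Poly_Mapping.single (u @ (x \<oplus>\<^bsub>M\<^esub> y) # v) 1
        - Poly_Mapping.single (u @ x # v) 1 - Poly_Mapping.single (u @ y # v) 1 \<in> S"
    and "\<And>u v c x. u \<in> L \<Longrightarrow> v \<in> L \<Longrightarrow> c \<in> K \<Longrightarrow> x \<in> carrier M \<Longrightarrow>
        Poly_Mapping.single (u @ (c \<odot>\<^bsub>M\<^esub> x) # v) 1 - Poly_Mapping.single (u @ x # v) c \<in> S"
  then have "?G1 \<union> ?G2 \<subseteq> S" by (intro Un_least subsetI) (elim CollectE exE conjE, simp)+
  then have "mod_span K F (?G1 \<union> ?G2) \<subseteq> S" using S(1) unfolding mod_span_def by (intro Inter_lower) simp
  then show "p \<in> S" using S(2) unfolding eq by (rule subsetD)
qed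

lemma prepend_F: "x \<in> carrier M \<Longrightarrow> p \<in> carrier F \<Longrightarrow> prepend x p \<in> carrier F"
  using cring_subring_ofD(1)[OF K] by (auto simp: carrier_F lookup_prepend split: list.splits)

lemma prepend_N: assumes x: "x \<in> carrier M" and "p \<in> N" shows "prepend x p \<in> N"
proof -
  note N = submodule_FD[OF submodule_N]
  have "submodule {p \<in> carrier F. prepend x p \<in> N} (subring_of K) F"
    by (rule submodule_FI) (auto simp: prepend_linear intro: carrier_F_sub N)
  then have "p \<in> {p \<in> carrier F. prepend x p \<in> N}"
  proof (rule N_induct)
    show "p \<in> N" by fact
  qed (use x gen_add[of "x # _"] gen_smult[of "x # _"] in
       \<open>auto simp: prepend_linear intro!: carrier_F_sub single_in_F M_closed cring_subring_ofD(2)[OF K]\<close>)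
  then show ?thesis by simp
qed

lemma prepend_head_add:
  assumes x: "x \<in> carrier M" "y \<in> carrier M" and p: "p \<in> carrier F"
  shows "prepend (x \<oplus>\<^bsub>M\<^esub> y) p - prepend x p - prepend y p \<in> N"
proof -
  note N = submodule_FD[OF submodule_N]
  let ?S = "{p \<in> carrier F. prepend (x \<oplus>\<^bsub>M\<^esub> y) p - prepend x p - prepend y p \<in> N}"
  have "submodule ?S (subring_of K) F"
  proof (rule submodule_FI)
    fix p q assume a: "p \<in> ?S" "q \<in> ?S"
    then show "p + q \<in> ?S"
      using N(3)[of "prepend (x \<oplus>\<^bsub>M\<^esub> y) p - prepend x p - prepend y p"
                    "prepend (x \<oplus>\<^bsub>M\<^esub> y) q - prepend x q - prepend y q"]
      by (auto simp: prepend_linear algebra_simps intro: carrier_F_sub)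
  next
    fix c p assume "c \<in> K" "p \<in> ?S"
    then show "fscale c p \<in> ?S"
      using N(4)[of c "prepend (x \<oplus>\<^bsub>M\<^esub> y) p - prepend x p - prepend y p"]
      by (auto simp: prepend_linear fscale_simps intro: carrier_F_sub)
  qed (auto simp: prepend_linear intro: carrier_F_sub N)
  then have "p \<in> ?S"
    by (rule F_induct[OF _ _ p])
       (use x gen_add[of "[]"] in \<open>auto simp: prepend_linear intro!: single_in_F cring_subring_ofD(2)[OF K]\<close>)
  then show ?thesis by simp
qed

lemma prepend_head_smult:
  assumes x: "x \<in> carrier M" "c \<in> K" and p: "p \<in> carrier F"
  shows "prepend (c \<odot>\<^bsub>M\<^esub> x) p - fscale c (prepend x p) \<in> N"
proof -
  note N = submodule_FD[OF submodule_N]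
  let ?S = "{p \<in> carrier F. prepend (c \<odot>\<^bsub>M\<^esub> x) p - fscale c (prepend x p) \<in> N}"
  have "submodule ?S (subring_of K) F"
  proof (rule submodule_FI)
    fix p q assume a: "p \<in> ?S" "q \<in> ?S"
    then show "p + q \<in> ?S"
      using N(3)[of "prepend (c \<odot>\<^bsub>M\<^esub> x) p - fscale c (prepend x p)"
                    "prepend (c \<odot>\<^bsub>M\<^esub> x) q - fscale c (prepend x q)"]
      by (auto simp: prepend_linear fscale_simps algebra_simps intro: carrier_F_sub)
  next
    fix b p assume "b \<in> K" "p \<in> ?S"
    then show "fscale b p \<in> ?S"
      using N(4)[of b "prepend (c \<odot>\<^bsub>M\<^esub> x) p - fscale c (prepend x p)"]
      by (auto simp: prepend_linear fscale_simps mult.commute intro: carrier_F_sub)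
  qed (auto simp: prepend_linear fscale_simps intro: carrier_F_sub N)
  then have "p \<in> ?S"
    by (rule F_induct[OF _ _ p])
       (use x gen_smult[of "[]"] in \<open>auto simp: prepend_linear fscale_simps intro!: single_in_F cring_subring_ofD(2)[OF K]\<close>)
  then show ?thesis by simp
qed

lemma shuffle_words_F: "u \<in> L \<Longrightarrow> v \<in> L \<Longrightarrow> shuffle_words u v \<in> carrier F"
  by (induction u v rule: shuffle_words.induct)
     (auto intro!: carrier_F_sub prepend_F single_in_F cring_subring_ofD(2)[OF K])

lemma shuffle_words_add:
  assumes "u1 \<in> L" "u2 \<in> L" "v \<in> L" "x \<in> carrier M" "y \<in> carrier M"
  shows "shuffle_words (u1 @ (x \<oplus>\<^bsub>M\<^esub> y) # u2) v - shuffle_words (u1 @ x # u2) v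
    - shuffle_words (u1 @ y # u2) v \<in> N"
  using assms
proof (induction "length u1 + length v" arbitrary: u1 v rule: less_induct)
  case less
  note N = submodule_FD[OF submodule_N]
  show ?case
  proof (cases v)
    case Nil then show ?thesis using less gen_add[of u1 u2 x y] by simp
  next
    case (Cons b v')
    have IH2: "prepend b (shuffle_words (u1 @ (x \<oplus>\<^bsub>M\<^esub> y) # u2) v' - shuffle_words (u1 @ x # u2) v'
       - shuffle_words (u1 @ y # u2) v') \<in> N"
      using less Cons by (intro prepend_N less.hyps) auto
    show ?thesis
    proof (cases u1)
      case Nil
      have "prepend (x \<oplus>\<^bsub>M\<^esub> y) (shuffle_words u2 v) - prepend x (shuffle_words u2 v)
        - prepend y (shuffle_words u2 v) \<in> N"
        using less by (intro prepend_head_add shuffle_words_F) auto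
      from N(3)[OF this IH2] show ?thesis
        using Nil Cons by (simp add: prepend_linear algebra_simps)
    next
      case (Cons a u1')
      have "prepend a (shuffle_words (u1' @ (x \<oplus>\<^bsub>M\<^esub> y) # u2) v - shuffle_words (u1' @ x # u2) v
       - shuffle_words (u1' @ y # u2) v) \<in> N"
        using less Cons by (intro prepend_N less.hyps) auto
      from N(3)[OF this IH2] show ?thesis
        using Cons \<open>v = b # v'\<close> by (simp add: prepend_linear algebra_simps)
    qed
  qed
qed

lemma shuffle_words_smult:
  assumes "u1 \<in> L" "u2 \<in> L" "v \<in> L" "x \<in> carrier M" "c \<in> K"
  shows "shuffle_words (u1 @ (c \<odot>\<^bsub>M\<^esub> x) # u2) v - fscale c (shuffle_words (u1 @ x # u2) v) \<in> N"
  using assms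
proof (induction "length u1 + length v" arbitrary: u1 v rule: less_induct)
  case less
  note N = submodule_FD[OF submodule_N]
  show ?case
  proof (cases v)
    case Nil then show ?thesis using less gen_smult[of u1 u2 c x] by (simp add: fscale_simps)
  next
    case (Cons b v')
    have IH2: "prepend b (shuffle_words (u1 @ (c \<odot>\<^bsub>M\<^esub> x) # u2) v' - fscale c (shuffle_words (u1 @ x # u2) v')) \<in> N"
      using less Cons by (intro prepend_N less.hyps) auto
    show ?thesis
    proof (cases u1)
      case Nil
      have "prepend (c \<odot>\<^bsub>M\<^esub> x) (shuffle_words u2 v) - fscale c (prepend x (shuffle_words u2 v)) \<in> N"
        using less by (intro prepend_head_smult shuffle_words_F) auto
      from N(3)[OF this IH2] show ?thesis
        using Nil Cons by (simp add: prepend_linear fscale_simps algebra_simps)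
    next
      case (Cons a u1')
      have "prepend a (shuffle_words (u1' @ (c \<odot>\<^bsub>M\<^esub> x) # u2) v - fscale c (shuffle_words (u1' @ x # u2) v)) \<in> N"
        using less Cons by (intro prepend_N less.hyps) auto
      from N(3)[OF this IH2] show ?thesis
        using Cons \<open>v = b # v'\<close> by (simp add: prepend_linear fscale_simps algebra_simps)
    qed
  qed
qed

lemma shuffle_free_F: assumes "p \<in> carrier F" "q \<in> carrier F" shows "shuffle_free p q \<in> carrier F"
proof -
  have "submodule {q \<in> carrier F. shuffle_free p q \<in> carrier F} (subring_of K) F"
    if "p \<in> carrier F" for p
    by (rule submodule_FI)
       (auto intro: carrier_F_sub simp: shuffle_free_commute[of p] shuffle_free_add shuffle_free_scale,
        simp add: shuffle_free_def carrier_F_sub)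
  note sub = this
  have 1: "shuffle_free p (Poly_Mapping.single w 1) \<in> carrier F" if "w \<in> L" for w
  proof -
    have s: "Poly_Mapping.single w 1 \<in> carrier F" using that by (intro single_in_F cring_subring_ofD(2)[OF K])
    have "p \<in> {q \<in> carrier F. shuffle_free (Poly_Mapping.single w 1) q \<in> carrier F}"
      by (rule F_induct[OF sub[OF s] _ assms(1)])
         (use that in \<open>auto simp: shuffle_free_single intro!: single_in_F shuffle_words_F cring_subring_ofD(2)[OF K]\<close>)
    then show ?thesis by (simp add: shuffle_free_commute)
  qed
  have "q \<in> {q \<in> carrier F. shuffle_free p q \<in> carrier F}"
    by (rule F_induct[OF sub[OF assms(1)] _ assms(2)])
       (auto simp: 1 intro!: single_in_F cring_subring_ofD(2)[OF K])
  then show ?thesis by simp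
qed

lemma shuffle_free_N: assumes p: "p \<in> N" and q: "q \<in> carrier F" shows "shuffle_free p q \<in> N"
proof -
  note N = submodule_FD[OF submodule_N]
  have sub1: "submodule {q \<in> carrier F. shuffle_free p q \<in> N} (subring_of K) F" for p
    by (rule submodule_FI)
       (auto intro: carrier_F_sub N simp: shuffle_free_commute[of p] shuffle_free_add shuffle_free_scale,
        simp add: shuffle_free_def N)
  have 1: "shuffle_free p (Poly_Mapping.single w 1) \<in> N" if w: "w \<in> L" for w
  proof -
    have "p \<in> {q \<in> carrier F. shuffle_free (Poly_Mapping.single w 1) q \<in> N}"
    proof (rule N_induct[OF sub1 p])
      fix u v x y assume a: "u \<in> L" "v \<in> L" "x \<in> carrier M" "y \<in> carrier M"
      then show "Poly_Mapping.single (u @ (x \<oplus>\<^bsub>M\<^esub> y) # v) 1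
        - Poly_Mapping.single (u @ x # v) 1 - Poly_Mapping.single (u @ y # v) 1 \<in>
          {q \<in> carrier F. shuffle_free (Poly_Mapping.single w 1) q \<in> N}"
        using w shuffle_words_add[of u v w x y]
        by (auto simp: shuffle_free_commute[of "Poly_Mapping.single w 1"] shuffle_free_diff shuffle_free_single
            intro!: carrier_F_sub single_in_F M_closed cring_subring_ofD(2)[OF K])
    next
      fix u v x c assume a: "u \<in> L" "v \<in> L" "c \<in> K" "x \<in> carrier M"
      have "Poly_Mapping.single (u @ x # v) c = fscale c (Poly_Mapping.single (u @ x # v) 1)"
        by (simp add: fscale_simps)
      with a show "Poly_Mapping.single (u @ (c \<odot>\<^bsub>M\<^esub> x) # v) 1 - Poly_Mapping.single (u @ x # v) c \<in>
          {q \<in> carrier F. shuffle_free (Poly_Mapping.single w 1) q \<in> N}"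
        using w shuffle_words_smult[of u v w x c]
        by (auto simp: shuffle_free_commute[of "Poly_Mapping.single w 1"] shuffle_free_diff shuffle_free_scale shuffle_free_single
            intro!: carrier_F_sub single_in_F M_closed cring_subring_ofD(2)[OF K])
    qed
    then show ?thesis by (simp add: shuffle_free_commute)
  qed
  have "q \<in> {q \<in> carrier F. shuffle_free p q \<in> N}"
    by (rule F_induct[OF sub1 _ q]) (auto simp: 1 intro!: single_in_F cring_subring_ofD(2)[OF K])
  then show ?thesis by simp
qed

lemma shuffle_coset:
  assumes p: "p \<in> carrier F" and q: "q \<in> carrier F"
  shows "shuffle K M (N +>\<^bsub>F\<^esub> p) (N +>\<^bsub>F\<^esub> q) = N +>\<^bsub>F\<^esub> shuffle_free p q"
proof -
  note N = submodule_FD[OF submodule_N]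
  interpret module "subring_of K" F by (rule module_F)
  interpret abelian_subgroup N F by (rule abelian_subgroup_submodule[OF module_F submodule_N])
  have "N +>\<^bsub>F\<^esub> shuffle_free p' q' = N +>\<^bsub>F\<^esub> shuffle_free p q"
    if p': "p' \<in> N +>\<^bsub>F\<^esub> p" and q': "q' \<in> N +>\<^bsub>F\<^esub> q" for p' q'
  proof -
    from p' obtain m where m: "m \<in> N" "p' = m + p" by (auto simp: a_r_coset_def' F_sel)
    from q' obtain n where n: "n \<in> N" "q' = n + q" by (auto simp: a_r_coset_def' F_sel)
    have c: "p' \<in> carrier F" using m p N(1) carrier_F_sub by auto
    have "shuffle_free p' q' = (shuffle_free n p' + shuffle_free m q) + shuffle_free p q"
      using m n shuffle_free_commute[of p' n] shuffle_free_add[of n q p'] shuffle_free_commute[of p' q']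
        shuffle_free_commute[of p' q] shuffle_free_add[of m p q]
      by (simp add: algebra_simps)
    moreover have "shuffle_free n p' + shuffle_free m q \<in> N"
      using m n c q by (intro N(3) shuffle_free_N) auto
    ultimately have "shuffle_free p' q' \<in> N +>\<^bsub>F\<^esub> shuffle_free p q"
      by (auto simp: a_r_coset_def' F_sel)
    then show ?thesis
      by (rule a_repr_independence'[symmetric]) (rule shuffle_free_F[OF p q])
  qed
  moreover have "p \<in> N +>\<^bsub>F\<^esub> p" "q \<in> N +>\<^bsub>F\<^esub> q" using p q a_rcos_self by auto
  ultimately show ?thesis unfolding shuffle_def by blast
qed

lemma shuffle_pure:
  "u \<in> L \<Longrightarrow> v \<in> L \<Longrightarrow> shuffle K M (pure_tensor K M u) (pure_tensor K M v) = N +>\<^bsub>F\<^esub> shuffle_words u v"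
  using shuffle_coset[of "Poly_Mapping.single u 1" "Poly_Mapping.single v 1"]
  by (simp add: pure_tensor_def single_in_F cring_subring_ofD(2)[OF K] shuffle_free_single)


lemma submodule_tensor_pos:
  "submodule (carrier (tensor_module_pos K M)) (subring_of K) (tensor_module K M)"
proof -
  have "{pure_tensor K M u | u. u \<in> L \<and> u \<noteq> []} \<subseteq> carrier (tensor_module K M)"
    using single_in_F[OF _ cring_subring_ofD(2)[OF K]]
    unfolding tensor_module_def carrier_quot_module[OF module_F submodule_N] pure_tensor_def by blast
  from submodule_mod_span[OF module_quot[OF module_F submodule_N, folded tensor_module_def] this]
  show ?thesis by (simp add: tensor_module_pos_def)
qed

lemma module_tensor_pos: "module (subring_of K) (tensor_module_pos K M)"
  using submodule.submodule_is_module[OF submodule_tensor_pos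
      module_quot[OF module_F submodule_N, folded tensor_module_def]]
  by (simp add: tensor_module_pos_def)

lemma pure_tensor_pos: "u \<in> L \<Longrightarrow> u \<noteq> [] \<Longrightarrow> pure_tensor K M u \<in> carrier (tensor_module_pos K M)"
  unfolding tensor_module_pos_def by (simp, rule subsetD[OF mod_span_incl], blast)

lemma coset_tensor_pos:
  assumes p: "p \<in> carrier F" and 0: "Poly_Mapping.lookup p [] = 0"
  shows "N +>\<^bsub>F\<^esub> p \<in> carrier (tensor_module_pos K M)"
proof -
  interpret T: module "subring_of K" "tensor_module_pos K M" by (rule module_tensor_pos)
  have sel: "zero (tensor_module_pos K M) = N" "add (tensor_module_pos K M) = add (quot_module F N)"
    "smult (tensor_module_pos K M) = smult (quot_module F N)"
    by (auto simp: tensor_module_pos_def tensor_module_def quot_module_def)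
  have "(\<Sum>w\<in>A. fscale (Poly_Mapping.lookup p w) (Poly_Mapping.single w 1)) \<in> carrier F \<and>
      N +>\<^bsub>F\<^esub> (\<Sum>w\<in>A. fscale (Poly_Mapping.lookup p w) (Poly_Mapping.single w 1)) \<in> carrier (tensor_module_pos K M)"
    if "A \<subseteq> Poly_Mapping.keys p" for A
    using finite_subset[OF that finite_keys] that
  proof (induction A rule: finite_induct)
    case empty
    interpret F: module "subring_of K" F by (rule module_F)
    interpret abelian_subgroup N F by (rule abelian_subgroup_submodule[OF module_F submodule_N])
    have "N +>\<^bsub>F\<^esub> 0 = N" using F.a_coset_add_zero[OF a_subset] by (simp add: F_sel)
    then show ?case using T.zero_closed by (simp add: sel carrier_F_sub(4))
  next
    case (insert w A)
    let ?c = "Poly_Mapping.lookup p w"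
    have w: "w \<in> L" "w \<noteq> []" "?c \<in> K" using insert p 0 by (auto simp: carrier_F in_keys_iff)
    then have s: "Poly_Mapping.single w 1 \<in> carrier F" by (intro single_in_F cring_subring_ofD(2)[OF K])
    have "?c \<odot>\<^bsub>quot_module F N\<^esub> pure_tensor K M w \<in> carrier (tensor_module_pos K M)"
      using T.smult_closed[of ?c "pure_tensor K M w"] w pure_tensor_pos[of w] by (simp add: sel subring_of_def)
    then have 1: "N +>\<^bsub>F\<^esub> fscale ?c (Poly_Mapping.single w 1) \<in> carrier (tensor_module_pos K M)"
      using quot_module_smult[OF module_F submodule_N, of ?c "Poly_Mapping.single w 1"] s w
      by (simp add: F_sel pure_tensor_def subring_of_def)
    have 2: "fscale ?c (Poly_Mapping.single w 1) \<in> carrier F" using s w by (intro carrier_F_sub)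
    from insert have IH: "(\<Sum>w\<in>A. fscale (Poly_Mapping.lookup p w) (Poly_Mapping.single w 1)) \<in> carrier F"
      "N +>\<^bsub>F\<^esub> (\<Sum>w\<in>A. fscale (Poly_Mapping.lookup p w) (Poly_Mapping.single w 1)) \<in> carrier (tensor_module_pos K M)"
      by auto
    show ?case
      using T.a_closed[OF 1 IH(2)] quot_module_add[OF module_F submodule_N 2 IH(1)] insert.hyps
        carrier_F_sub(1)[OF 2 IH(1)]
      by (simp add: sel F_sel)
  qed
  from this[of "Poly_Mapping.keys p"] have "N +>\<^bsub>F\<^esub> (\<Sum>w\<in>Poly_Mapping.keys p.
    fscale (Poly_Mapping.lookup p w) (Poly_Mapping.single w 1)) \<in> carrier (tensor_module_pos K M)" by simp
  moreover have "(\<Sum>w\<in>Poly_Mapping.keys p. fscale (Poly_Mapping.lookup p w) (Poly_Mapping.single w 1)) = p"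
    by (rule poly_mapping_eqI) (auto simp: fscale_simps lookup_sum lookup_single when_def in_keys_iff)
  ultimately show ?thesis by simp
qed

lemma shuffle_pure_pos:
  assumes "u \<in> L" "v \<in> L" "u \<noteq> [] \<or> v \<noteq> []"
  shows "shuffle K M (pure_tensor K M u) (pure_tensor K M v) \<in> carrier (tensor_module_pos K M)"
proof -
  have "Poly_Mapping.lookup (shuffle_words u v :: _ \<Rightarrow>\<^sub>0 'a) [] = 0"
    using assms(3) by (induction u v rule: shuffle_words.induct) (auto simp: lookup_single lookup_add lookup_prepend)
  then show ?thesis
    using assms by (simp add: shuffle_pure coset_tensor_pos shuffle_words_F)
qed

end

lemma module_sym_square:
  assumes K: "cring (subring_of K)" and M: "module (subring_of K) M"
  shows "module (subring_of K) (sym_square K M)"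
    "\<And>x y. x \<in> carrier M \<Longrightarrow> y \<in> carrier M \<Longrightarrow> sym_prod K M x y \<in> carrier (sym_square K M)"
proof -
  note k = cring_subring_ofD[OF K]
  interpret M: module "subring_of K" M by (rule M)
  have P: "module (subring_of K) (pair_module K M)" unfolding pair_module_def by (rule module_free[OF K])
  have single: "Poly_Mapping.single (x, y) c \<in> carrier (pair_module K M)"
    if "x \<in> carrier M" "y \<in> carrier M" "c \<in> K" for x y c
    using that k by (auto simp: pair_module_def carrier_free_module[OF k(1)] lookup_single when_def split: if_splits)
  have diff: "p - q \<in> carrier (pair_module K M)"
    if "p \<in> carrier (pair_module K M)" "q \<in> carrier (pair_module K M)" for p q
    using that k(3)[OF _ k(5), unfolded diff_conv_add_uminus[symmetric]]
    by (simp add: pair_module_def carrier_free_module[OF k(1)] lookup_minus) (metis diff_0_right)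
  have smult: "c \<in> K \<Longrightarrow> x \<in> carrier M \<Longrightarrow> c \<odot>\<^bsub>M\<^esub> x \<in> carrier M" for c x
    using M.smult_closed[of c x] by (simp add: subring_of_def)
  have R: "submodule (sym_square_rels K M) (subring_of K) (pair_module K M)"
    unfolding sym_square_rels_def
    by (rule submodule_mod_span[OF P], intro Un_least subsetI; elim CollectE exE conjE)
       (simp_all add: diff single smult k(1,2))
  show "module (subring_of K) (sym_square K M)"
    unfolding sym_square_def by (rule module_quot[OF P R])
  show "sym_prod K M x y \<in> carrier (sym_square K M)" if "x \<in> carrier M" "y \<in> carrier M" for x y
    using single[OF that k(2)] by (auto simp: sym_square_def carrier_quot_module[OF P R] sym_prod_def)
qed

lemma eps_closed:
  assumes K: "cring (subring_of K)" and M: "module (subring_of K) M"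
    and "s \<in> carrier (tensor_module_pos K M)" "t \<in> carrier (tensor_module_pos K M)"
  shows "eps K M s t \<in> carrier (sym_alg K (M2 K M))"
proof -
  note k = cring_subring_ofD[OF K]
  note S = module_sym_square[OF K module_tensor_pos[OF K M], folded M2_def]
  interpret ideal "sym_alg_rels K (M2 K M)" "poly_ring K (carrier (M2 K M))"
    by (rule cring_sym_alg[OF K S(1)])
  have "Poly_Mapping.single {#x#} 1 \<in> carrier (poly_ring K (carrier (M2 K M)))"
    if "x \<in> carrier (M2 K M)" for x
    using that k by (auto simp: poly_ring_def range_subset_iff[OF k(1)] lookup_single when_def split: if_splits)
  from this[OF S(2)[OF assms(3,4)]] show ?thesis
    by (auto simp: eps_def sym_incl_def sym_alg_def FactRing_def A_RCOSETS_def')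
qed

lemma J2_generator_closed:
  assumes K: "cring (subring_of K)" and M: "module (subring_of K) M"
    and w: "f \<in> lists (carrier M)" "g \<in> lists (carrier M)" "h \<in> lists (carrier M)"
    and n: "f \<noteq> []" "g \<noteq> []" "h \<noteq> []"
  shows "J2_generator K M f g h \<in> carrier (sym_alg K (M2 K M))"
proof -
  interpret A: cring "sym_alg K (M2 K M)"
    by (rule cring_sym_alg[OF K module_sym_square(1)[OF K module_tensor_pos[OF K M], folded M2_def]])
  have td: "take i u \<in> lists (carrier M)" "drop i u \<in> lists (carrier M)"
    if "u \<in> lists (carrier M)" for u i
    using that by (auto dest: in_set_takeD in_set_dropD)
  note pos = pure_tensor_pos[OF K M]
  note shpos = shuffle_pure_pos[OF K M]
  have a: "pure_tensor K M (drop i u) \<in> carrier (tensor_module_pos K M)"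
    if "u \<in> lists (carrier M)" "i < length u" for i u
    using that by (intro pos td) auto
  have b: "shuffle K M (pure_tensor K M (take i u)) (pure_tensor K M (take j v))
      \<in> carrier (tensor_module_pos K M)"
    if "u \<in> lists (carrier M)" "v \<in> lists (carrier M)" "i < length u" "j < length v" "i + j \<ge> 1" for i j u v
    using that by (intro shpos td) auto
  note e = eps_closed[OF K M]
  have 1: "eps K M (shuffle K M (pure_tensor K M f) (pure_tensor K M g)) (pure_tensor K M h)
      \<in> carrier (sym_alg K (M2 K M))"
    "eps K M (pure_tensor K M f) (shuffle K M (pure_tensor K M g) (pure_tensor K M h))
      \<in> carrier (sym_alg K (M2 K M))"
    by (rule e; (rule shpos pos)?; use w n in blast)+
  have 2: "eps K M (pure_tensor K M (drop i f)) (pure_tensor K M (drop j g)) \<otimes>\<^bsub>sym_alg K (M2 K M)\<^esub>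
       eps K M (shuffle K M (pure_tensor K M (take i f)) (pure_tensor K M (take j g))) (pure_tensor K M h)
      \<in> carrier (sym_alg K (M2 K M))"
    if "j \<in> {0..<length g}" "i \<in> {1 - j..<length f}" for i j
    by (rule A.m_closed; rule e; (rule a b pos)?; use w n that in \<open>simp; linarith?\<close>)
  have 3: "eps K M (pure_tensor K M f) (shuffle K M (pure_tensor K M (take j g)) (pure_tensor K M (take k h)))
       \<otimes>\<^bsub>sym_alg K (M2 K M)\<^esub> eps K M (pure_tensor K M (drop j g)) (pure_tensor K M (drop k h))
      \<in> carrier (sym_alg K (M2 K M))"
    if "j \<in> {0..<length g}" "k \<in> {1 - j..<length h}" for j k
    by (rule A.m_closed; rule e; (rule a b pos)?; use w n that in \<open>simp; linarith?\<close>)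
  show ?thesis
    unfolding J2_generator_def Let_def
    by (rule A.a_closed A.minus_closed 1 A.finsum_closed Pi_I 2 3 | assumption)+
qed

lemma cring_C2:
  assumes K: "cring (subring_of K)" and M: "module (subring_of K) M"
  shows "ideal (J2 K M) (sym_alg K (M2 K M))" "cring (C2 K M)"
proof -
  interpret A: cring "sym_alg K (M2 K M)"
    by (rule cring_sym_alg[OF K module_sym_square(1)[OF K module_tensor_pos[OF K M], folded M2_def]])
  show *: "ideal (J2 K M) (sym_alg K (M2 K M))"
    unfolding J2_def by (rule A.genideal_ideal) (auto intro!: J2_generator_closed[OF K M])
  show "cring (C2 K M)"
    unfolding C2_def by (rule ideal.quotient_is_cring[OF * A.is_cring])
qed

end

theory Submission
  imports Defs
begin

text \<open>
  Write \<open>c(V, W)\<close> for the class of the symmetric product of the tensors of two words. The relations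
  that define \<^const>\<open>C2\<close> say that \<open>c(f \<squnion> g, h) = c(f, g \<squnion> h)\<close>, with \<open>\<squnion>\<close> the shuffle product, up to a sum
  of products \<open>c(x, y) * c(z, w)\<close> in which both factors involve fewer letters than \<open>f\<close>, \<open>g\<close>, \<open>h\<close> together.
  By induction on the total number of letters, these products already lie in the subalgebra \<open>B\<close>
  generated by the index pairs, so that modulo \<open>B\<close> the bilinear form \<open>c\<close> is symmetric and associative
  with respect to shuffling.

  Now let \<open>V\<close> be the maximal shuffle of \<open>V1\<close> and \<open>V2\<close>. Then \<open>V1 \<squnion> V2\<close> is a positive multiple of \<open>V\<close> plus
  multiples of lexicographically smaller words of the same length, and the multiple is invertible
  because the rationals are among the constants. Hence \<open>c(V, W)\<close> is a combination of
  \<open>c(V1 \<squnion> V2, W)\<close>, which may be replaced by \<open>c(V1, V2 \<squnion> W)\<close>, and of values \<open>c(U, W)\<close> with \<open>U\<close> smaller than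
  \<open>V\<close>. Take \<open>V\<close> to be the smaller word of the pair. If \<open>V\<close> is not a Lyndon word, then it is the maximal
  shuffle of two nonempty words, and the rewriting leads to pairs whose smaller member is below \<open>V\<close>.
  If \<open>W\<close> is the maximal shuffle of \<open>W1\<close> and \<open>W2\<close> with \<open>W1\<close> below \<open>V\<close>, then rewriting at \<open>W\<close> leads to pairs
  containing \<open>W1\<close>, or to \<open>V\<close> paired with a word below \<open>W\<close>. Since the occurring letters stay in a finite
  set, this terminates, and the pairs on which it stops are the index pairs:
  lemma \<open>words_paired_if_index_pairs_paired\<close>.

  The only combinatorial input is that a word that is not Lyndon is a maximal shuffle
  (\<open>not_lyndon_imp_max_shuffle\<close>): it is cut in front of its least suffix. The rest is multilinear
  algebra: \<open>B\<close> is handled through its preimage in the symmetric algebra, and a subring of the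
  symmetric algebra that contains the constants and all \<open>c(V, W)\<close> with \<open>V\<close>, \<open>W\<close> words over module
  generators is the whole algebra (\<open>sym_alg_M2_generated\<close>).
\<close>


section \<open>Maximal shuffles and Lyndon words\<close>

abbreviation (input) lex_le :: "'i::linorder list \<Rightarrow> 'i list \<Rightarrow> bool"
  where "lex_le u v \<equiv> u = v \<or> lex_less u v"

lemma lex_less_simps [simp]:
  "lex_less [] v \<longleftrightarrow> v \<noteq> []" "\<not> lex_less u []"
  "lex_less (x # u) (y # v) \<longleftrightarrow> x < y \<or> x = y \<and> lex_less u v"
  by (auto simp: lex_less_def neq_Nil_conv)

lemma lex_less_append_left [simp]: "lex_less (s @ u) (s @ v) \<longleftrightarrow> lex_less u v"
  by (induction s) auto

lemma lex_less_irrefl [simp]: "\<not> lex_less u u"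
  by (induction u) auto

lemma lex_less_trans: "lex_less u v \<Longrightarrow> lex_less v w \<Longrightarrow> lex_less u w"
  unfolding lex_less_def by (rule lexord_trans) (auto intro: transI)

lemma lex_less_linear: "lex_less u v \<or> u = v \<or> lex_less v u"
proof (induction u arbitrary: v)
  case (Cons x u)
  then show ?case by (cases v) auto
qed simp

lemma lex_less_imp_prefix_or_append:
  "lex_less s v \<Longrightarrow> prefix s v \<or> lex_less (s @ z) v"
proof (induction s arbitrary: v)
  case (Cons x s)
  then show ?case by (cases v) auto
qed simp

text \<open>
  The best way to merge two words is always to continue with the lexicographically larger of the two
  remainders. This is the exchange argument behind it: among the pairs \<open>w @ p, q\<close> and \<open>p, w @ q\<close>, the
  one in which the larger word \<open>p\<close> is available at once admits shuffles that are at least as large.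
\<close>

lemma shuffles_exchange_prefix:
  assumes "lex_le q p" "X \<in> shuffles (w @ p) q"
  shows "\<exists>Y\<in>shuffles p (w @ q). lex_le X Y"
  using assms
proof (induction X arbitrary: w p q)
  case (Cons c X)
  show ?case
  proof (cases w)
    case Nil
    with Cons.prems show ?thesis by auto
  next
    case w: (Cons e w')
    from Cons.prems(2) w consider (left) "e = c" "X \<in> shuffles (w' @ p) q"
      | (right) q' where "q = c # q'" "X \<in> shuffles (w @ p) q'"
      by (cases q) (auto simp: Cons_in_shuffles_iff)
    then show ?thesis
    proof cases
      case left
      from Cons.IH[OF Cons.prems(1) left(2)]
      obtain Y where "Y \<in> shuffles p (w' @ q)" "lex_le X Y" by blast
      with left w show ?thesis by (intro bexI[of _ "c # Y"]) (auto intro: Cons_in_shuffles_rightI)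
    next
      case right
      with Cons.prems(1) obtain d p' where p: "p = d # p'" "c < d \<or> c = d \<and> lex_le q' p'"
        by (cases p) auto
      show ?thesis
      proof (cases "c < d")
        case True
        then show ?thesis using p
          by (intro bexI[of _ "d # splice p' (w @ q)"])
             (auto intro!: Cons_in_shuffles_leftI simp del: splice.simps)
      next
        case False
        with p have cd: "c = d" "lex_le q' p'" by auto
        \<comment> \<open>the common first letter is taken from \<open>p\<close> instead, and joins the prefix \<open>w\<close>\<close>
        have "X \<in> shuffles ((w @ [c]) @ p') q'" using right p cd by simp
        from Cons.IH[OF cd(2) this]
        obtain Y where "Y \<in> shuffles p' (w @ q)" "lex_le X Y" using right by auto
        with p cd show ?thesis by (intro bexI[of _ "c # Y"]) (auto intro: Cons_in_shuffles_leftI)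
      qed
    qed
  qed
qed simp

lemma append_in_shuffles: "u @ v \<in> shuffles u v"
  by (induction u) (auto intro: Cons_in_shuffles_leftI)

text \<open>
  Every nonempty suffix \<open>s\<close> of \<open>P\<close> is at least \<open>U\<close>. Otherwise, as \<open>s @ U\<close> is a suffix and hence at least
  \<open>U\<close>, the word \<open>s\<close> is a proper prefix of \<open>U\<close>, and cancelling it yields a suffix below \<open>U\<close>. So the
  greedy merge of \<open>P\<close> and \<open>U\<close> may use up all of \<open>P\<close> before it turns to \<open>U\<close>.
\<close>

lemma append_least_suffix_is_max_shuffle:
  assumes U: "U \<noteq> []" and least: "\<And>t. t \<noteq> [] \<Longrightarrow> suffix t (P @ U) \<Longrightarrow> lex_le U t"
  shows "is_max_shuffle (P @ U) P U"
proof -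
  have "lex_le X (P @ U)" if "X \<in> shuffles P U" for X
    using that least
  proof (induction P arbitrary: X)
    case (Cons a P)
    note least = Cons.prems(2)
    have IH: "lex_le Y (P @ U)" if "Y \<in> shuffles P U" for Y
      using Cons.IH[OF that] least by (simp add: suffix_Cons)
    from U Cons.prems(1) consider
        (left) Y where "X = a # Y" "Y \<in> shuffles P U"
      | (right) b U' Y where "U = b # U'" "X = b # Y" "Y \<in> shuffles (a # P) U'"
      by (cases X; cases U) (auto simp: Cons_in_shuffles_iff)
    then show ?case
    proof cases
      case left
      with IH show ?thesis by auto
    next
      case right
      have le: "lex_le U (a # P)"
      proof (rule ccontr)
        assume "\<not> lex_le U (a # P)"
        then have less: "lex_less (a # P) U" using lex_less_linear by blast
        have UPU: "lex_le U ((a # P) @ U)" using least[of "a # P @ U"] by simp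
        moreover have "\<not> lex_less ((a # P) @ U) U"
          using UPU lex_less_trans lex_less_irrefl by metis
        ultimately obtain t where t: "U = (a # P) @ t"
          using lex_less_imp_prefix_or_append[OF less, of U] by (auto simp: prefix_def)
        with less have "t \<noteq> []" by auto
        moreover have "suffix t (a # P @ U)"
          unfolding t suffix_def by (metis append_Cons append_assoc)
        ultimately have "lex_le U t" using least[of t] by simp
        moreover have "lex_less t U"
          using UPU t by (metis append_same_eq lex_less_append_left list.discI append_self_conv2 same_append_eq)
        ultimately show False using lex_less_trans lex_less_irrefl by metis
      qed
      show ?thesis
      proof (cases "b < a")
        case False
        with le right(1) have ab: "a = b" "lex_le U' P" by auto
        with right obtain Y' where "Y' \<in> shuffles P U" "lex_le Y Y'"
          using shuffles_exchange_prefix[of U' P Y "[a]"] by auto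
        with IH right ab show ?thesis using lex_less_trans by (metis append_Cons lex_less_simps(3))
      qed (use right in auto)
    qed
  qed simp
  then show ?thesis by (auto simp: is_max_shuffle_def append_in_shuffles)
qed

lemma ex_least_suffix:
  "V \<noteq> [] \<Longrightarrow> \<exists>U. U \<noteq> [] \<and> suffix U V \<and> (\<forall>t. t \<noteq> [] \<and> suffix t V \<longrightarrow> lex_le U t)"
proof (induction V)
  case (Cons x V)
  show ?case
  proof (cases "V = []")
    case True
    then show ?thesis by (intro exI[of _ "[x]"]) (auto simp: suffix_Cons)
  next
    case False
    with Cons.IH obtain U where "U \<noteq> []" "suffix U V" "\<forall>t. t \<noteq> [] \<and> suffix t V \<longrightarrow> lex_le U t"
      by blast
    then have U: "U \<noteq> []" "suffix U V" "\<And>t. t \<noteq> [] \<Longrightarrow> suffix t V \<Longrightarrow> lex_le U t" by blast+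
    show ?thesis
    proof (cases "lex_less U (x # V)")
      case True
      with U show ?thesis by (intro exI[of _ U]) (auto simp: suffix_Cons)
    next
      case False
      then have "lex_le (x # V) U" using lex_less_linear by blast
      with U(3) have "lex_le (x # V) t" if "t \<noteq> []" "suffix t V" for t
        using that lex_less_trans by metis
      then show ?thesis by (intro exI[of _ "x # V"]) (auto simp: suffix_Cons)
    qed
  qed
qed simp

text \<open>
  The least suffix of a word that is not Lyndon is a proper one.
\<close>

lemma not_lyndon_imp_max_shuffle:
  assumes "V \<noteq> []" "\<not> lyndon V"
  obtains V1 V2 where "V1 \<noteq> []" "V2 \<noteq> []" "V = V1 @ V2" "is_max_shuffle V V1 V2"
proof -
  obtain U where U: "U \<noteq> []" "suffix U V" "\<And>t. t \<noteq> [] \<Longrightarrow> suffix t V \<Longrightarrow> lex_le U t"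
    using ex_least_suffix[OF assms(1)] by blast
  from U(2) obtain P where P: "V = P @ U" by (auto simp: suffix_def)
  have "P \<noteq> []"
  proof
    assume "P = []"
    with P U have "lyndon V" by (auto simp: lyndon_def strict_suffix_def)
    with assms(2) show False ..
  qed
  with that U P append_least_suffix_is_max_shuffle[of U P] show thesis by blast
qed


section \<open>Multiplicities in shuffle products\<close>

lemma prepend_sum: "prepend x (sum f A) = (\<Sum>w\<in>A. prepend x (f w))"
  by (induction A rule: infinite_finite_induct) (simp_all add: prepend_linear)

text \<open>
  The multiplicities \<open>n\<close> are those of the words over the index set, so they do not depend on
  coincidences between the letters \<open>a i\<close>, and they are positive natural numbers on shuffles. Both matter
  later: the coefficient of the maximal shuffle has to be invertible.
\<close>

lemma shuffle_words_map:
  fixes a :: "'i \<Rightarrow> 'm"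
  obtains n :: "'i list \<Rightarrow> nat" where "\<And>w. 0 < n w \<longleftrightarrow> w \<in> shuffles u v"
    "shuffle_words (map a u) (map a v) =
      (\<Sum>w\<in>shuffles u v. Poly_Mapping.single (map a w) (of_nat (n w) :: 'a::comm_ring_1))"
proof -
  have "\<exists>n :: 'i list \<Rightarrow> nat. (\<forall>w. 0 < n w \<longleftrightarrow> w \<in> shuffles u v) \<and>
    shuffle_words (map a u) (map a v) =
      (\<Sum>w\<in>shuffles u v. Poly_Mapping.single (map a w) (of_nat (n w) :: 'a))"
  proof (induction u v rule: shuffle_words.induct)
    case (1 v)
    show ?case by (intro exI[of _ "\<lambda>w. if w = v then 1 else 0"]) simp
  next
    case (2 x u)
    show ?case by (intro exI[of _ "\<lambda>w. if w = x # u then 1 else 0"]) simp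
  next
    case (3 x u y v)
    let ?A = "shuffles u (y # v)" and ?B = "shuffles (x # u) v"
    from 3 obtain n1 n2 :: "'i list \<Rightarrow> nat"
      where n1: "\<forall>w. 0 < n1 w \<longleftrightarrow> w \<in> ?A"
          "shuffle_words (map a u) (map a (y # v)) =
            (\<Sum>w\<in>?A. Poly_Mapping.single (map a w) (of_nat (n1 w) :: 'a))"
        and n2: "\<forall>w. 0 < n2 w \<longleftrightarrow> w \<in> ?B"
          "shuffle_words (map a (x # u)) (map a v) =
            (\<Sum>w\<in>?B. Poly_Mapping.single (map a w) (of_nat (n2 w) :: 'a))"
      by blast
    \<comment> \<open>multiplicities of the words that start with \<open>z\<close>, in terms of the word after that letter\<close>
    define ext :: "'i \<Rightarrow> ('i list \<Rightarrow> nat) \<Rightarrow> 'i list \<Rightarrow> nat"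
      where "ext z n w = (case w of [] \<Rightarrow> 0 | z' # w' \<Rightarrow> if z' = z then n w' else 0)" for z n w
    have prep: "prepend (a z) (\<Sum>w\<in>C. Poly_Mapping.single (map a w) (of_nat (n w) :: 'a)) =
        (\<Sum>w\<in>S. Poly_Mapping.single (map a w) (of_nat (ext z n w)))"
      if n: "\<forall>w. 0 < n w \<longleftrightarrow> w \<in> C" and S: "(#) z ` C \<subseteq> S" "finite S" for z n C S
    proof -
      have "prepend (a z) (\<Sum>w\<in>C. Poly_Mapping.single (map a w) (of_nat (n w) :: 'a)) =
          (\<Sum>w\<in>(#) z ` C. Poly_Mapping.single (map a w) (of_nat (ext z n w)))"
        by (subst sum.reindex) (auto simp: prepend_sum prepend_linear ext_def)
      also have "\<dots> = (\<Sum>w\<in>S. Poly_Mapping.single (map a w) (of_nat (ext z n w)))"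
      proof (rule sum.mono_neutral_left)
        show "\<forall>w\<in>S - (#) z ` C. Poly_Mapping.single (map a w) (of_nat (ext z n w) :: 'a) = 0"
        proof
          fix w assume "w \<in> S - (#) z ` C"
          then have "ext z n w = 0" using n by (auto simp: ext_def split: list.split)
          then show "Poly_Mapping.single (map a w) (of_nat (ext z n w) :: 'a) = 0" by simp
        qed
      qed (use S in auto)
      finally show ?thesis .
    qed
    let ?n = "\<lambda>w. ext x n1 w + ext y n2 w"
    have "shuffle_words (map a (x # u)) (map a (y # v)) =
        (\<Sum>w\<in>shuffles (x # u) (y # v). Poly_Mapping.single (map a w) (of_nat (?n w) :: 'a))"
      using prep[OF n1(1), of x "shuffles (x # u) (y # v)"] prep[OF n2(1), of y "shuffles (x # u) (y # v)"]
        n1(2) n2(2)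
      by (simp add: single_add sum.distrib del: shuffles.simps)
         (auto simp: sum.distrib)
    moreover have "0 < ?n w \<longleftrightarrow> w \<in> shuffles (x # u) (y # v)" for w
      using n1(1) n2(1) by (auto simp: ext_def split: list.split)
    ultimately show ?case by (intro exI[of _ ?n] conjI allI)
  qed
  with that show thesis by blast
qed

lemma shuffle_words_map_closed:
  fixes a :: "'i \<Rightarrow> 'm" and P :: "('m list \<Rightarrow>\<^sub>0 'a::comm_ring_1) \<Rightarrow> bool"
  assumes K: "cring (subring_of K)"
    and add: "\<And>p q. P p \<Longrightarrow> P q \<Longrightarrow> P (p + q)"
    and scale: "\<And>c p. c \<in> K \<Longrightarrow> P p \<Longrightarrow> P (fscale c p)"
    and words: "\<And>w. w \<in> shuffles u v \<Longrightarrow> P (Poly_Mapping.single (map a w) 1)"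
  shows "P (shuffle_words (map a u) (map a v))"
proof -
  note k = cring_subring_ofD[OF K]
  have of_nat_K: "of_nat n \<in> K" for n by (induction n) (auto intro: k)
  obtain n where n: "shuffle_words (map a u) (map a v) =
      (\<Sum>w\<in>shuffles u v. Poly_Mapping.single (map a w) (of_nat (n w) :: 'a))"
    by (rule shuffle_words_map[of u v a]) (rule that)
  have monom: "P (Poly_Mapping.single (map a w) (of_nat (n w)))" if "w \<in> shuffles u v" for w
    using scale[OF of_nat_K words[OF that]] by (simp add: fscale_simps)
  have "P 0" using scale[OF k(1) words[OF append_in_shuffles]] by (simp add: fscale_simps)
  then have "P (\<Sum>w\<in>A. Poly_Mapping.single (map a w) (of_nat (n w)))" if "A \<subseteq> shuffles u v" for A
    using that by (induction A rule: infinite_finite_induct) (auto intro!: add monom)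
  then show ?thesis unfolding n by blast
qed

lemma fscale_minus_one: "fscale (- 1) p = - p"
  by (rule poly_mapping_eqI) simp

lemma contains_rationals_inverse:
  assumes "contains_rationals K" "n > 0"
  shows "\<exists>k\<in>K. k * of_nat n = (1::'a::comm_ring_1)"
proof -
  obtain h :: "rat \<Rightarrow> 'a" where h: "h \<in> ring_hom (subring_of UNIV) (subring_of K)"
    using assms(1) by (auto simp: contains_rationals_def)
  have hom: "h (x + y) = h x + h y" "h (x * y) = h x * h y" "h 1 = 1" "h x \<in> K" for x y
    using ring_hom_add[OF h, of x y] ring_hom_mult[OF h, of x y] ring_hom_one[OF h]
      ring_hom_closed[OF h, of x] by (auto simp: subring_of_def)
  have "h 0 = 0" using hom(1)[of 0 0] by simp
  then have "h (of_nat m) = of_nat m" for m by (induction m) (simp_all add: hom)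
  then have "h (1 / of_nat n) * of_nat n = 1"
    using hom(2)[of "1 / of_nat n" "of_nat n"] assms(2) hom(3) by simp
  with hom(4) show ?thesis by blast
qed


section \<open>Reduction of all pairs of words to index pairs\<close>

lemma dlex_less_iff: "dlex_less V W \<longleftrightarrow> length V < length W \<or> length V = length W \<and> lex_less V W"
  by (auto simp: dlex_less_def lex_less_def lenlex_conv lexord_lex)

lemma dlex_less_trans: "dlex_less U V \<Longrightarrow> dlex_less V W \<Longrightarrow> dlex_less U W"
  using lex_less_trans by (auto simp: dlex_less_iff)

lemma dlex_less_linear: "dlex_less V W \<or> V = W \<or> dlex_less W V"
  using lex_less_linear[of V W] by (auto simp: dlex_less_iff)

text \<open>
  On an infinite alphabet the order need not be well-founded. Restricting the letters to a finite set
  repairs this, and the rewriting of a pair never introduces new letters.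
\<close>

lemma wf_dlex_less_on:
  assumes "finite F"
  shows "wf {(V, W). V \<in> lists F \<and> W \<in> lists F \<and> dlex_less V W}"
proof (rule wf_subset)
  let ?r = "{(x, y). x < y \<and> x \<in> F \<and> y \<in> F}"
  have "finite ?r" by (rule finite_subset[of _ "F \<times> F"]) (use assms in auto)
  moreover have "acyclic ?r"
    by (rule acyclicI_order[of _ "id :: 'a \<Rightarrow> 'a", THEN acyclic_converse[THEN iffD1]]) auto
  ultimately show "wf (lenlex ?r)" by (intro wf_lenlex finite_acyclic_wf)
  show "{(V, W). V \<in> lists F \<and> W \<in> lists F \<and> dlex_less V W} \<subseteq> lenlex ?r"
    by (auto simp: dlex_less_def lenlex_conv lex_conv) blast+
qed

text \<open>
  The induction of the whole argument, separated from the algebra: \<open>G p q\<close> stands for the statement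
  that the value of the symmetric bilinear form at \<open>p\<close> and \<open>q\<close> belongs to a given subring. The
  assumption \<open>assoc\<close> allows one factor of a shuffle product to be moved to the other argument as soon as
  all pairs with fewer letters have been dealt with. For a fixed total length the pairs, with the
  smaller word first, are ordered lexicographically by their two words.
\<close>

lemma words_paired_if_index_pairs_paired:
  fixes a :: "'i::linorder \<Rightarrow> 'm"
    and G :: "('m list \<Rightarrow>\<^sub>0 'a::comm_ring_1) \<Rightarrow> ('m list \<Rightarrow>\<^sub>0 'a) \<Rightarrow> bool"
  assumes K: "cring (subring_of K)" and rat: "contains_rationals K"
    and sym: "\<And>p q. G p q \<Longrightarrow> G q p"
    and add: "\<And>p p' q. G p q \<Longrightarrow> G p' q \<Longrightarrow> G (p + p') q"
    and scale: "\<And>c p q. c \<in> K \<Longrightarrow> G p q \<Longrightarrow> G (fscale c p) q"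
    and assoc: "\<And>U V W. U \<in> lists I \<Longrightarrow> V \<in> lists I \<Longrightarrow> W \<in> lists I \<Longrightarrow>
      U \<noteq> [] \<Longrightarrow> V \<noteq> [] \<Longrightarrow> W \<noteq> [] \<Longrightarrow>
      (\<And>X Y. X \<in> lists I \<Longrightarrow> Y \<in> lists I \<Longrightarrow> X \<noteq> [] \<Longrightarrow> Y \<noteq> [] \<Longrightarrow>
        length X + length Y < length U + length V + length W \<Longrightarrow>
        G (Poly_Mapping.single (map a X) 1) (Poly_Mapping.single (map a Y) 1)) \<Longrightarrow>
      G (Poly_Mapping.single (map a U) 1) (shuffle_words (map a V) (map a W)) \<Longrightarrow>
      G (shuffle_words (map a U) (map a V)) (Poly_Mapping.single (map a W) 1)"
    and index: "\<And>V W. (V, W) \<in> index_pairs I \<Longrightarrow>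
      G (Poly_Mapping.single (map a V) 1) (Poly_Mapping.single (map a W) 1)"
    and VW: "V \<in> lists I" "W \<in> lists I" "V \<noteq> []" "W \<noteq> []"
  shows "G (Poly_Mapping.single (map a V) 1) (Poly_Mapping.single (map a W) 1)"
proof -
  define e :: "'i list \<Rightarrow> ('m list \<Rightarrow>\<^sub>0 'a)" where "e W = Poly_Mapping.single (map a W) 1" for W
  note assoc = assoc[folded e_def] and index = index[folded e_def]
  note k = cring_subring_ofD[OF K]
  have of_nat_K: "of_nat n \<in> K" for n by (induction n) (auto intro: k)
  have zero: "G 0 q" if "G p q" for p q
    using scale[OF k(1) that] by (simp add: fscale_simps)
  have sum_G: "G (sum f A) q" if "G p q" "\<And>x. x \<in> A \<Longrightarrow> G (f x) q"
    for f :: "'i list \<Rightarrow> _" and A p q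
    using that by (induction A rule: infinite_finite_induct) (auto intro: zero add)
  have monom: "G (Poly_Mapping.single (map a U) c) q" if "c \<in> K" "G (e U) q" for U c q
    using scale[OF that] by (simp add: e_def fscale_simps)
  have shuffleI: "G (shuffle_words (map a U) (map a V)) q"
    if "\<And>X. X \<in> shuffles U V \<Longrightarrow> G (e X) q" for U V q
    by (rule shuffle_words_map_closed[OF K]) (use that in \<open>auto simp: e_def intro: add scale\<close>)
  \<comment> \<open>solve the shuffle product for its largest word; this divides by the multiplicity of \<open>X\<close>\<close>
  have max_shuffleD: "G (e X) q"
    if X: "is_max_shuffle X U V" and G: "G (shuffle_words (map a U) (map a V)) q"
      and less: "\<And>Y. Y \<in> shuffles U V \<Longrightarrow> lex_less Y X \<Longrightarrow> G (e Y) q" for X U V q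
  proof -
    obtain n where n: "\<And>w. 0 < n w \<longleftrightarrow> w \<in> shuffles U V" "shuffle_words (map a U) (map a V) =
      (\<Sum>w\<in>shuffles U V. Poly_Mapping.single (map a w) (of_nat (n w) :: 'a))"
      by (rule shuffle_words_map[of U V a]) (rule that)
    have XS: "X \<in> shuffles U V" and le: "\<And>Y. Y \<in> shuffles U V \<Longrightarrow> Y = X \<or> lex_less Y X"
      using X by (auto simp: is_max_shuffle_def)
    from le have rest: "G (\<Sum>w\<in>shuffles U V - {X}. Poly_Mapping.single (map a w) (of_nat (n w))) q"
      by (intro sum_G[OF G] monom of_nat_K less) auto
    have "shuffle_words (map a U) (map a V) = Poly_Mapping.single (map a X) (of_nat (n X))
        + (\<Sum>w\<in>shuffles U V - {X}. Poly_Mapping.single (map a w) (of_nat (n w) :: 'a))"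
      unfolding n(2) by (rule sum.remove) (use XS in auto)
    then have "Poly_Mapping.single (map a X) (of_nat (n X)) = shuffle_words (map a U) (map a V)
        + fscale (-1) (\<Sum>w\<in>shuffles U V - {X}. Poly_Mapping.single (map a w) (of_nat (n w) :: 'a))"
      by (simp add: fscale_minus_one)
    then have *: "G (Poly_Mapping.single (map a X) (of_nat (n X))) q"
      using G rest k by (auto intro!: add scale)
    have "0 < n X" using n(1) XS by blast
    from contains_rationals_inverse[OF rat this]
    obtain c where "c \<in> K" "c * of_nat (n X) = 1" by blast
    with scale[OF this(1) *] show ?thesis by (simp add: fscale_simps e_def)
  qed
  show ?thesis
    unfolding e_def[symmetric] using VW
  proof (induction "length V + length W" arbitrary: V W rule: less_induct)
    case (less V W)
    let ?F = "set V \<union> set W" and ?N = "length V + length W"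
    let ?r = "{(V, W). V \<in> lists ?F \<and> W \<in> lists ?F \<and> dlex_less V W}"
    have FI: "?F \<subseteq> I" using less.prems by auto
    have shorter: "G (e X) (e Y)" if "X \<in> lists I" "Y \<in> lists I" "X \<noteq> []" "Y \<noteq> []"
      "length X + length Y < ?N" for X Y
      using less.hyps that by blast
    have ordered: "G (e A) (e B)"
      if "A \<in> lists ?F" "B \<in> lists ?F" "A \<noteq> []" "B \<noteq> []" "length A + length B = ?N"
        "A = B \<or> dlex_less A B" for A B
    proof -
      have "wf (?r <*lex*> ?r)" by (intro wf_lex_prod wf_dlex_less_on) simp_all
      then show ?thesis using that
      proof (induction "(A, B)" arbitrary: A B rule: wf_induct_rule)
        case (less A B)
        note prems = less.prems
        have AB: "A \<in> lists I" "B \<in> lists I" using prems FI by auto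
        \<comment> \<open>induction hypothesis for pairs with a member below \<open>A\<close>, in whichever order the two words are\<close>
        have first: "G (e A') (e B')"
          if "A' \<in> lists ?F" "B' \<in> lists ?F" "A' \<noteq> []" "B' \<noteq> []" "length A' + length B' = ?N"
            "dlex_less A' A" for A' B'
        proof (cases "dlex_less B' A'")
          case True
          with that less.hyps[of B' A'] prems dlex_less_trans[of B' A' A] show ?thesis
            by (intro sym[of "e B'"]) (auto simp: add.commute)
        next
          case False
          with that less.hyps[of A' B'] prems dlex_less_linear[of A' B'] show ?thesis by auto
        qed
        \<comment> \<open>induction hypothesis for \<open>A\<close> and a word below \<open>B\<close>, which may now be the smaller of the two\<close>
        have second: "G (e B') (e A)"
          if "B' \<in> lists ?F" "B' \<noteq> []" "length A + length B' = ?N" "dlex_less B' B" for B'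
        proof (cases "dlex_less B' A")
          case True
          with that prems show ?thesis by (intro first) auto
        next
          case False
          with that less.hyps[of A B'] prems dlex_less_linear[of A B'] show ?thesis
            by (intro sym[of "e A"]) auto
        qed
        show ?case
        proof (cases "lyndon A")
          case False
          \<comment> \<open>\<open>A1\<close> is shorter than \<open>A\<close>, so after moving \<open>A2\<close> to the other side all pairs are covered by \<open>first\<close>\<close>
          then obtain A1 A2 where A12: "A1 \<noteq> []" "A2 \<noteq> []" "A = A1 @ A2" "is_max_shuffle A A1 A2"
            using not_lyndon_imp_max_shuffle prems(3) by blast
          show ?thesis
          proof (rule max_shuffleD[OF A12(4)])
            fix Y assume Y: "Y \<in> shuffles A1 A2" "lex_less Y A"
            with A12 prems set_shuffles[OF Y(1)] length_shuffles[OF Y(1)] show "G (e Y) (e B)"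
              by (intro first) (auto simp: dlex_less_iff)
          next
            show "G (shuffle_words (map a A1) (map a A2)) (e B)"
            proof (rule assoc)
              show "G (e A1) (shuffle_words (map a A2) (map a B))"
              proof (rule sym, rule shuffleI, rule sym)
                fix X assume X: "X \<in> shuffles A2 B"
                with A12 prems set_shuffles[OF X] length_shuffles[OF X] show "G (e A1) (e X)"
                  by (intro first) (auto simp: dlex_less_iff)
              qed
            qed (use A12 prems AB in \<open>auto intro: shorter\<close>)
          qed
        next
          case lyndon: True
          show ?thesis
          proof (cases "(A, B) \<in> index_pairs I")
            case False
            with lyndon prems AB obtain B1 B2 where B12: "B1 \<in> lists I" "B2 \<in> lists I" "B1 \<noteq> []"
              "B2 \<noteq> []" "dlex_less B1 A" "is_max_shuffle B B1 B2"
              unfolding index_pairs_def by blast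
            then have B: "B \<in> shuffles B1 B2" by (simp add: is_max_shuffle_def)
            note lenB = length_shuffles[OF B]
            have BF: "B1 \<in> lists ?F" "B2 \<in> lists ?F"
              using prems(2) set_shuffles[OF B] by (auto simp: in_lists_conv_set)
            \<comment> \<open>here it is \<open>B2\<close> that moves, leaving \<open>B1\<close>, which is below \<open>A\<close>\<close>
            have "G (e B) (e A)"
            proof (rule max_shuffleD[OF B12(6)])
              fix Y assume Y: "Y \<in> shuffles B1 B2" "lex_less Y B"
              have "set Y = set B1 \<union> set B2" "length Y = length B1 + length B2"
                using set_shuffles[OF Y(1)] length_shuffles[OF Y(1)] .
              moreover from this have "Y \<in> lists ?F" using BF by auto
              ultimately show "G (e Y) (e A)"
                using Y(2) prems(5) lenB B12(3) by (intro second) (auto simp: dlex_less_iff)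
            next
              show "G (shuffle_words (map a B1) (map a B2)) (e A)"
              proof (rule assoc)
                show "G (e B1) (shuffle_words (map a B2) (map a A))"
                proof (rule sym, rule shuffleI, rule sym)
                  fix X assume X: "X \<in> shuffles B2 A"
                  have "set X = set B2 \<union> set A" "length X = length B2 + length A"
                    using set_shuffles[OF X] length_shuffles[OF X] .
                  moreover from this have "X \<in> lists ?F" using BF prems(1) by auto
                  ultimately show "G (e B1) (e X)"
                    using prems(3,5) lenB B12 BF(1) by (intro first) auto
                qed
              qed (use B12 prems AB lenB in \<open>auto intro: shorter\<close>)
            qed
            then show ?thesis by (rule sym)
          qed (rule index)
        qed
      qed
    qed
    show ?case
    proof (cases "dlex_less W V")
      case True
      with less.prems show ?thesis by (intro sym[of "e W"] ordered) auto
    next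
      case False
      with less.prems dlex_less_linear[of V W] show ?thesis by (intro ordered) auto
    qed
  qed
qed


section \<open>Subrings, submodules and cosets\<close>

lemma poly_mapping_monomial_induct:
  fixes p :: "'k \<Rightarrow>\<^sub>0 'b::comm_monoid_add"
  assumes "P 0" "\<And>q r. P q \<Longrightarrow> P r \<Longrightarrow> P (q + r)"
    and "\<And>k. k \<in> Poly_Mapping.keys p \<Longrightarrow> P (Poly_Mapping.single k (Poly_Mapping.lookup p k))"
  shows "P p"
proof -
  have "P (\<Sum>k\<in>A. Poly_Mapping.single k (Poly_Mapping.lookup p k))" if "A \<subseteq> Poly_Mapping.keys p" for A
    using that by (induction A rule: infinite_finite_induct) (auto intro!: assms)
  moreover have "(\<Sum>k\<in>Poly_Mapping.keys p. Poly_Mapping.single k (Poly_Mapping.lookup p k)) = p"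
    by (rule poly_mapping_eqI) (auto simp: lookup_sum lookup_single when_def in_keys_iff)
  ultimately show ?thesis by (metis order_refl)
qed

lemma a_rcos_eqI:
  fixes p q :: "'b::ab_group_add"
  assumes "abelian_subgroup N G" "add G = (+)" "q \<in> carrier G" "p - q \<in> N"
  shows "N +>\<^bsub>G\<^esub> p = N +>\<^bsub>G\<^esub> q"
proof -
  interpret abelian_subgroup N G by fact
  have "p \<in> N +>\<^bsub>G\<^esub> q"
    unfolding a_r_coset_def' using assms(2,4) by (auto intro!: bexI[of _ "p - q"])
  then show ?thesis using assms(3) by (rule a_repr_independence'[symmetric])
qed

lemma abelian_subgroup_ideal: "ideal I R \<Longrightarrow> abelian_subgroup I R"
  by (intro abelian_subgroupI3 ideal.axioms(1) ring.is_abelian_group ideal.axioms(2))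

lemma subring_preimage:
  assumes "ring_hom_ring R S h" "subring B S"
  shows "subring {x \<in> carrier R. h x \<in> B} R"
proof -
  interpret ring_hom_ring R S h by fact
  show ?thesis
    by (rule R.subringI) (use subringE[OF assms(2)] in auto)
qed

lemma (in ring) finsum_in_subring:
  assumes B: "subring B R" and f: "\<And>x. x \<in> X \<Longrightarrow> f x \<in> B"
  shows "finsum R f X \<in> B"
proof -
  note B = subringE[OF B]
  show ?thesis
    using f
  proof (induction X rule: infinite_finite_induct)
    case (insert x X)
    then show ?case using B by (subst finsum_insert) auto
  qed (use B in auto)
qed

text \<open>
  The way in which a defining relation \<open>x - y + s\<close> is used: if it vanishes modulo a subring that
  contains \<open>y\<close> and the correction term \<open>s\<close>, then \<open>x\<close> lies in that subring.
\<close>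

lemma (in ring) subring_diff_cancel:
  assumes B: "subring B R" and x: "x \<in> carrier R" "y \<in> B" "s \<in> B" "(x \<ominus> y) \<oplus> s \<in> B"
  shows "x \<in> B"
proof -
  note E = subringE[OF B]
  have c: "y \<in> carrier R" "s \<in> carrier R" using x E(1) by auto
  have "((x \<ominus> y) \<oplus> s) \<oplus> (\<ominus> s \<oplus> y) \<in> B" using x E(5,7) by blast
  also have "((x \<ominus> y) \<oplus> s) \<oplus> (\<ominus> s \<oplus> y) = (x \<ominus> y) \<oplus> ((s \<oplus> \<ominus> s) \<oplus> y)"
    using x(1) c by (simp add: a_assoc)
  also have "\<dots> = x"
    using x(1) c by (simp add: r_neg minus_eq a_assoc l_neg)
  finally show ?thesis .
qed

text \<open>
  Closure under negation comes for free, since \<open>- 1\<close> is a scalar.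
\<close>

lemma subring_of_module_submoduleI:
  assumes "module (subring_of K) M" "H \<subseteq> carrier M" "\<zero>\<^bsub>M\<^esub> \<in> H"
    "\<And>x y. x \<in> H \<Longrightarrow> y \<in> H \<Longrightarrow> x \<oplus>\<^bsub>M\<^esub> y \<in> H" "\<And>c x. c \<in> K \<Longrightarrow> x \<in> H \<Longrightarrow> c \<odot>\<^bsub>M\<^esub> x \<in> H"
  shows "submodule H (subring_of K) M"
proof -
  interpret module "subring_of K" M by fact
  have neg: "\<ominus>\<^bsub>subring_of K\<^esub> \<one>\<^bsub>subring_of K\<^esub> \<in> K"
    using R.a_inv_closed[OF R.one_closed] by (simp add: subring_of_def)
  have "\<ominus>\<^bsub>M\<^esub> x \<in> H" if "x \<in> H" for x
  proof -
    have "\<ominus>\<^bsub>M\<^esub> x = (\<ominus>\<^bsub>subring_of K\<^esub> \<one>\<^bsub>subring_of K\<^esub>) \<odot>\<^bsub>M\<^esub> x"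
      using that assms(2) by (subst smult_l_minus) (auto simp: subset_iff)
    with neg assms(5) that show ?thesis by simp
  qed
  then show ?thesis
    by (intro submoduleI) (use assms in \<open>auto simp: subring_of_def\<close>)
qed

lemma mod_span_least: "submodule N (subring_of K) M \<Longrightarrow> X \<subseteq> N \<Longrightarrow> mod_span K M X \<subseteq> N"
  by (auto simp: mod_span_def)


section \<open>Universal constructions and their generators\<close>

lemma genideal_incl: "X \<subseteq> Idl\<^bsub>R\<^esub> X"
  by (auto simp: genideal_def)

context
  fixes K :: "'a::comm_ring_1 set" and S :: "('a, 's, 'z) module_scheme"
  assumes K: "cring (subring_of K)" and S: "module (subring_of K) S"
begin

private abbreviation (input) SR where "SR \<equiv> poly_ring K (carrier S)"
private abbreviation (input) SJ where "SJ \<equiv> sym_alg_rels K S"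
private abbreviation (input) SA where "SA \<equiv> sym_alg K S"

lemma sym_alg_quotient_hom: "(+>\<^bsub>SR\<^esub>) SJ \<in> ring_hom SR SA"
  unfolding sym_alg_def by (rule ideal.rcos_ring_hom[OF cring_sym_alg(1)[OF K S]])

lemma single_poly_ring:
  "set_mset m \<subseteq> carrier S \<Longrightarrow> c \<in> K \<Longrightarrow> Poly_Mapping.single m c \<in> carrier SR"
  using cring_subring_ofD(1)[OF K]
  by (auto simp: poly_ring_def range_subset_iff[OF cring_subring_ofD(1)[OF K]] lookup_single when_def split: if_splits)

lemma sym_alg_coset_eqI:
  "q \<in> carrier SR \<Longrightarrow> p - q \<in> SJ \<Longrightarrow> SJ +>\<^bsub>SR\<^esub> p = SJ +>\<^bsub>SR\<^esub> q"
  by (rule a_rcos_eqI[OF abelian_subgroup_ideal[OF cring_sym_alg(1)[OF K S]]]) (simp_all add: poly_ring_def)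

lemma sym_incl_closed: "x \<in> carrier S \<Longrightarrow> sym_incl K S x \<in> carrier SA"
  unfolding sym_incl_def
  by (rule ring_hom_closed[OF sym_alg_quotient_hom]) (simp add: single_poly_ring cring_subring_ofD(2)[OF K])

lemma sym_const_closed: "c \<in> K \<Longrightarrow> sym_const K S c \<in> carrier SA"
  unfolding sym_const_def
  by (rule ring_hom_closed[OF sym_alg_quotient_hom]) (simp add: single_poly_ring)

lemma sym_incl_add:
  assumes x: "x \<in> carrier S" "y \<in> carrier S"
  shows "sym_incl K S (x \<oplus>\<^bsub>S\<^esub> y) = sym_incl K S x \<oplus>\<^bsub>SA\<^esub> sym_incl K S y"
proof -
  interpret S: module "subring_of K" S by (rule S)
  let ?s = "\<lambda>x. Poly_Mapping.single {#x#} (1::'a)"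
  have s: "?s z \<in> carrier SR" if "z \<in> carrier S" for z
    using that by (simp add: single_poly_ring cring_subring_ofD(2)[OF K])
  have "?s (x \<oplus>\<^bsub>S\<^esub> y) - ?s x - ?s y \<in> SJ"
    unfolding sym_alg_rels_def by (rule subsetD[OF genideal_incl], rule UnI1) (use x in blast)
  then have "SJ +>\<^bsub>SR\<^esub> ?s (x \<oplus>\<^bsub>S\<^esub> y) = SJ +>\<^bsub>SR\<^esub> (?s x \<oplus>\<^bsub>SR\<^esub> ?s y)"
    using x s ring.ring_simprules(1)[OF cring.axioms(1)[OF cring_poly_ring[OF K]] s s]
    by (intro sym_alg_coset_eqI) (simp_all add: poly_ring_def algebra_simps)
  with x s show ?thesis
    unfolding sym_incl_def by (simp add: ring_hom_add[OF sym_alg_quotient_hom])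
qed

lemma sym_incl_smult:
  assumes x: "x \<in> carrier S" "c \<in> K"
  shows "sym_incl K S (c \<odot>\<^bsub>S\<^esub> x) = sym_const K S c \<otimes>\<^bsub>SA\<^esub> sym_incl K S x"
proof -
  interpret S: module "subring_of K" S by (rule S)
  let ?s = "\<lambda>x. Poly_Mapping.single {#x#} (1::'a)"
  have s: "?s x \<in> carrier SR" "Poly_Mapping.single {#} c \<in> carrier SR" "Poly_Mapping.single {#x#} c \<in> carrier SR"
    using x by (simp_all add: single_poly_ring cring_subring_ofD(2)[OF K])
  have "?s (c \<odot>\<^bsub>S\<^esub> x) - Poly_Mapping.single {#x#} c \<in> SJ"
    unfolding sym_alg_rels_def by (rule subsetD[OF genideal_incl], rule UnI2) (use x in blast)
  then have "SJ +>\<^bsub>SR\<^esub> ?s (c \<odot>\<^bsub>S\<^esub> x) = SJ +>\<^bsub>SR\<^esub> (Poly_Mapping.single {#} c \<otimes>\<^bsub>SR\<^esub> ?s x)"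
    using s by (intro sym_alg_coset_eqI) (simp_all add: poly_ring_def mult_single)
  with x s show ?thesis
    unfolding sym_incl_def sym_const_def
    by (simp add: ring_hom_mult[OF sym_alg_quotient_hom])
qed

text \<open>
  A monomial is a constant times a product of variables, so constants and variables suffice.
\<close>

lemma sym_alg_generated:
  assumes B: "subring B SA" "sym_const K S ` K \<subseteq> B" "sym_incl K S ` carrier S \<subseteq> B"
  shows "carrier SA \<subseteq> B"
proof -
  note E = subringE[OF B(1)]
  note hom = ring_hom_add[OF sym_alg_quotient_hom] ring_hom_mult[OF sym_alg_quotient_hom]
  have monom: "SJ +>\<^bsub>SR\<^esub> Poly_Mapping.single m c \<in> B" if "set_mset m \<subseteq> carrier S" "c \<in> K" for m c
    using that(1)
  proof (induction m)
    case empty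
    then show ?case using B(2) that(2) by (auto simp: sym_const_def)
  next
    case (add x m)
    then have "SJ +>\<^bsub>SR\<^esub> (Poly_Mapping.single {#x#} 1 \<otimes>\<^bsub>SR\<^esub> Poly_Mapping.single m c) \<in> B"
      using B(3) that(2)
      by (subst hom) (auto simp: sym_incl_def image_subset_iff single_poly_ring cring_subring_ofD(2)[OF K] intro!: E(6))
    then show ?case by (simp add: poly_ring_def mult_single)
  qed
  have "p \<in> carrier SR \<and> SJ +>\<^bsub>SR\<^esub> p \<in> B" if p: "p \<in> carrier SR" for p
  proof (rule poly_mapping_monomial_induct[of _ p])
    have "0 \<in> K" by (rule cring_subring_ofD(1)[OF K])
    then show "0 \<in> carrier SR \<and> SJ +>\<^bsub>SR\<^esub> 0 \<in> B"
      using monom[of "{#}" 0] single_poly_ring[of "{#}" 0] by simp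
  next
    fix q r assume qr: "q \<in> carrier SR \<and> SJ +>\<^bsub>SR\<^esub> q \<in> B" "r \<in> carrier SR \<and> SJ +>\<^bsub>SR\<^esub> r \<in> B"
    then have "SJ +>\<^bsub>SR\<^esub> (q \<oplus>\<^bsub>SR\<^esub> r) \<in> B" "q \<oplus>\<^bsub>SR\<^esub> r \<in> carrier SR"
      using ring.ring_simprules(1)[OF cring.axioms(1)[OF cring_poly_ring[OF K]]]
      by (auto simp: hom intro: E(7))
    then show "q + r \<in> carrier SR \<and> SJ +>\<^bsub>SR\<^esub> (q + r) \<in> B" by (simp add: poly_ring_def)
  next
    fix m assume "m \<in> Poly_Mapping.keys p"
    with p have "set_mset m \<subseteq> carrier S" "Poly_Mapping.lookup p m \<in> K"
      by (auto simp: poly_ring_def range_subset_iff[OF cring_subring_ofD(1)[OF K]])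
    then show "Poly_Mapping.single m (Poly_Mapping.lookup p m) \<in> carrier SR \<and>
        SJ +>\<^bsub>SR\<^esub> Poly_Mapping.single m (Poly_Mapping.lookup p m) \<in> B"
      using monom single_poly_ring by blast
  qed
  then show ?thesis by (auto simp: sym_alg_def FactRing_def A_RCOSETS_def')
qed

text \<open>
  The bridge between linear and multiplicative generation: a subring that contains the constants is
  closed under scalar multiplication, so membership in it may be tested on module generators.
\<close>

lemma submodule_preimage_subring:
  fixes M :: "('a, 'm, 'y) module_scheme"
  assumes M: "module (subring_of K) M" and B: "subring B SA" "sym_const K S ` K \<subseteq> B"
    and closed: "\<And>x. x \<in> carrier M \<Longrightarrow> \<phi> x \<in> carrier SA"
    and add: "\<And>x y. x \<in> carrier M \<Longrightarrow> y \<in> carrier M \<Longrightarrow> \<phi> (x \<oplus>\<^bsub>M\<^esub> y) = \<phi> x \<oplus>\<^bsub>SA\<^esub> \<phi> y"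
    and smult: "\<And>c x. c \<in> K \<Longrightarrow> x \<in> carrier M \<Longrightarrow> \<phi> (c \<odot>\<^bsub>M\<^esub> x) = sym_const K S c \<otimes>\<^bsub>SA\<^esub> \<phi> x"
  shows "submodule {x \<in> carrier M. \<phi> x \<in> B} (subring_of K) M"
proof -
  interpret M: module "subring_of K" M by (rule M)
  interpret A: cring SA by (rule cring_sym_alg(2)[OF K S])
  note E = subringE[OF B(1)]
  have "\<phi> \<zero>\<^bsub>M\<^esub> \<oplus>\<^bsub>SA\<^esub> \<phi> \<zero>\<^bsub>M\<^esub> = \<phi> \<zero>\<^bsub>M\<^esub>" using add[of "\<zero>\<^bsub>M\<^esub>" "\<zero>\<^bsub>M\<^esub>"] by simp
  then have "\<phi> \<zero>\<^bsub>M\<^esub> = \<zero>\<^bsub>SA\<^esub>" using closed[OF M.zero_closed] by (metis A.add.r_cancel_one')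
  then show ?thesis
    by (intro subring_of_module_submoduleI[OF M])
       (use B(2) M.smult_closed in \<open>auto simp: add smult E subring_of_def\<close>)
qed

end

lemma single_in_free_module:
  "cring (subring_of K) \<Longrightarrow> x \<in> X \<Longrightarrow> c \<in> K \<Longrightarrow> Poly_Mapping.single x c \<in> carrier (free_module K X)"
  using cring_subring_ofD(1)[of K]
  by (auto simp: carrier_free_module lookup_single when_def split: if_splits)

lemma diff_in_free_module:
  assumes "cring (subring_of K)" "p \<in> carrier (free_module K X)" "q \<in> carrier (free_module K X)"
  shows "p - q \<in> carrier (free_module K X)"
proof -
  note k = cring_subring_ofD[OF assms(1)]
  have "x - y \<in> K" if "x \<in> K" "y \<in> K" for x y
    using k(3)[OF that(1) k(5)[OF that(2)]] by simp
  then show ?thesis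
    using assms(2,3) by (simp add: carrier_free_module[OF k(1)] lookup_minus) (metis diff_0_right)
qed

lemma zero_in_submodule: "submodule N R M \<Longrightarrow> \<zero>\<^bsub>M\<^esub> \<in> N"
  using subgroup.one_closed[OF submodule.axioms(1)] by fastforce

lemma free_module_sel: "add (free_module K X) = (+)" "smult (free_module K X) = fscale"
  "zero (free_module K X) = 0"
  by (simp_all add: free_module_def)

lemma quot_free_module_generated:
  assumes K: "cring (subring_of K)" and N: "submodule N (subring_of K) (free_module K X)"
    and Y: "submodule Y (subring_of K) (quot_module (free_module K X) N)"
    and gen: "\<And>x. x \<in> X \<Longrightarrow> N +>\<^bsub>free_module K X\<^esub> Poly_Mapping.single x 1 \<in> Y"
  shows "carrier (quot_module (free_module K X) N) \<subseteq> Y"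
proof -
  let ?F = "free_module K X"
  note k = cring_subring_ofD[OF K]
  have F: "module (subring_of K) ?F" by (rule module_free[OF K])
  interpret F: module "subring_of K" ?F by (rule F)
  interpret N: abelian_subgroup N ?F by (rule abelian_subgroup_submodule[OF F N])
  note E = module.submoduleE[OF module_quot[OF F N] Y]
  have "p \<in> carrier ?F \<and> N +>\<^bsub>?F\<^esub> p \<in> Y" if p: "p \<in> carrier ?F" for p
  proof (rule poly_mapping_monomial_induct[of _ p])
    have "\<zero>\<^bsub>quot_module ?F N\<^esub> \<in> Y" using Y by (rule zero_in_submodule)
    then show "0 \<in> carrier ?F \<and> N +>\<^bsub>?F\<^esub> 0 \<in> Y"
      using F.zero_closed F.a_coset_add_zero[OF N.a_subset] by (simp add: free_module_sel quot_module_def)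
  next
    fix q r assume qr: "q \<in> carrier ?F \<and> N +>\<^bsub>?F\<^esub> q \<in> Y" "r \<in> carrier ?F \<and> N +>\<^bsub>?F\<^esub> r \<in> Y"
    then show "q + r \<in> carrier ?F \<and> N +>\<^bsub>?F\<^esub> (q + r) \<in> Y"
      using E(5)[of "N +>\<^bsub>?F\<^esub> q" "N +>\<^bsub>?F\<^esub> r"] quot_module_add[OF F N, of q r] F.a_closed[of q r]
      by (simp add: free_module_sel)
  next
    fix x assume "x \<in> Poly_Mapping.keys p"
    with p have x: "x \<in> X" "Poly_Mapping.lookup p x \<in> K"
      by (auto simp: carrier_free_module[OF k(1)] in_keys_iff)
    have s: "Poly_Mapping.single x 1 \<in> carrier ?F" "Poly_Mapping.single x (Poly_Mapping.lookup p x) \<in> carrier ?F"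
      using x by (auto intro!: single_in_free_module K k)
    show "Poly_Mapping.single x (Poly_Mapping.lookup p x) \<in> carrier ?F \<and>
        N +>\<^bsub>?F\<^esub> Poly_Mapping.single x (Poly_Mapping.lookup p x) \<in> Y"
      using quot_module_smult[OF F N _ s(1), of "Poly_Mapping.lookup p x"]
        E(4)[OF _ gen[OF x(1)], of "Poly_Mapping.lookup p x"] x s
      by (simp add: free_module_sel fscale_simps subring_of_def)
  qed
  then show ?thesis unfolding carrier_quot_module[OF F N] by blast
qed

context
  fixes K :: "'a::comm_ring_1 set" and M :: "('a, 'm, 'z) module_scheme"
  assumes K: "cring (subring_of K)" and M: "module (subring_of K) M"
begin

private abbreviation (input) PF where "PF \<equiv> pair_module K M"
private abbreviation (input) PN where "PN \<equiv> sym_square_rels K M"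

lemma module_pair: "module (subring_of K) PF"
  unfolding pair_module_def by (rule module_free[OF K])

lemma single_pair: "x \<in> carrier M \<Longrightarrow> y \<in> carrier M \<Longrightarrow> c \<in> K \<Longrightarrow> Poly_Mapping.single (x, y) c \<in> carrier PF"
  unfolding pair_module_def by (simp add: single_in_free_module[OF K])

lemma submodule_sym_square_rels: "submodule PN (subring_of K) PF"
proof -
  note diff = diff_in_free_module[OF K, of _ "carrier M \<times> carrier M", folded pair_module_def]
  show ?thesis
    unfolding sym_square_rels_def
    by (rule submodule_mod_span[OF module_pair], intro Un_least subsetI; elim CollectE exE conjE)
       (simp_all add: diff single_pair M_closed[OF K M] cring_subring_ofD(2)[OF K])
qed

lemma sym_square_coset_eqI: "q \<in> carrier PF \<Longrightarrow> p - q \<in> PN \<Longrightarrow> PN +>\<^bsub>PF\<^esub> p = PN +>\<^bsub>PF\<^esub> q"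
  by (rule a_rcos_eqI[OF abelian_subgroup_submodule[OF module_pair submodule_sym_square_rels]])
     (simp_all add: pair_module_def free_module_sel)

lemma sym_prod_add:
  assumes x: "x \<in> carrier M" "y \<in> carrier M" "z \<in> carrier M"
  shows "sym_prod K M (x \<oplus>\<^bsub>M\<^esub> y) z = sym_prod K M x z \<oplus>\<^bsub>sym_square K M\<^esub> sym_prod K M y z"
proof -
  let ?s = "\<lambda>x. Poly_Mapping.single (x, z) (1::'a)"
  have s: "?s x \<in> carrier PF" "?s y \<in> carrier PF"
    using x by (simp_all add: single_pair cring_subring_ofD(2)[OF K])
  have "?s (x \<oplus>\<^bsub>M\<^esub> y) - ?s x - ?s y \<in> PN"
    unfolding sym_square_rels_def by (rule subsetD[OF mod_span_incl]) (use x in blast)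
  moreover have "?s x + ?s y \<in> carrier PF"
    using abelian_monoid.a_closed[OF abelian_group.axioms(1)[OF module.axioms(2)[OF module_pair]] s]
    by (simp add: pair_module_def free_module_sel)
  ultimately have "PN +>\<^bsub>PF\<^esub> ?s (x \<oplus>\<^bsub>M\<^esub> y) = PN +>\<^bsub>PF\<^esub> (?s x + ?s y)"
    by (intro sym_square_coset_eqI) (simp_all add: algebra_simps)
  with quot_module_add[OF module_pair submodule_sym_square_rels s] show ?thesis
    by (simp add: sym_prod_def sym_square_def pair_module_def free_module_sel)
qed

lemma sym_prod_smult:
  assumes x: "x \<in> carrier M" "z \<in> carrier M" "c \<in> K"
  shows "sym_prod K M (c \<odot>\<^bsub>M\<^esub> x) z = c \<odot>\<^bsub>sym_square K M\<^esub> sym_prod K M x z"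
proof -
  have s: "Poly_Mapping.single (x, z) 1 \<in> carrier PF" "Poly_Mapping.single (x, z) c \<in> carrier PF"
    using x by (simp_all add: single_pair cring_subring_ofD(2)[OF K])
  have "Poly_Mapping.single (c \<odot>\<^bsub>M\<^esub> x, z) 1 - Poly_Mapping.single (x, z) c \<in> PN"
    unfolding sym_square_rels_def by (rule subsetD[OF mod_span_incl]) (use x in blast)
  with s(2) have "PN +>\<^bsub>PF\<^esub> Poly_Mapping.single (c \<odot>\<^bsub>M\<^esub> x, z) 1 = PN +>\<^bsub>PF\<^esub> Poly_Mapping.single (x, z) c"
    by (intro sym_square_coset_eqI)
  with quot_module_smult[OF module_pair submodule_sym_square_rels _ s(1), of c] x(3) show ?thesis
    by (simp add: sym_prod_def sym_square_def pair_module_def free_module_sel fscale_simps subring_of_def)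
qed

lemma sym_prod_commute:
  assumes x: "x \<in> carrier M" "y \<in> carrier M"
  shows "sym_prod K M x y = sym_prod K M y x"
  unfolding sym_prod_def
proof (rule sym_square_coset_eqI)
  show "Poly_Mapping.single (x, y) 1 - Poly_Mapping.single (y, x) 1 \<in> PN"
    unfolding sym_square_rels_def by (rule subsetD[OF mod_span_incl]) (use x in blast)
qed (use x in \<open>simp add: single_pair cring_subring_ofD(2)[OF K]\<close>)

lemma sym_square_generated:
  assumes Y: "submodule Y (subring_of K) (sym_square K M)"
    and gen: "\<And>x y. x \<in> carrier M \<Longrightarrow> y \<in> carrier M \<Longrightarrow> sym_prod K M x y \<in> Y"
  shows "carrier (sym_square K M) \<subseteq> Y"
  using quot_free_module_generated[OF K submodule_sym_square_rels[unfolded pair_module_def],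
      folded pair_module_def, folded sym_square_def, OF Y] gen
  by (auto simp: sym_prod_def)

end

context
  fixes K :: "'a::comm_ring_1 set" and M :: "('a, 'm, 'z) module_scheme"
  assumes K: "cring (subring_of K)" and M: "module (subring_of K) M"
begin

private abbreviation (input) F where "F \<equiv> word_module K M"
private abbreviation (input) N where "N \<equiv> tensor_rels K M"
private abbreviation (input) L where "L \<equiv> lists (carrier M)"
private abbreviation (input) T where "T \<equiv> tensor_module_pos K M"
private abbreviation (input) A where "A \<equiv> sym_alg K (M2 K M)"

lemma tensor_coset_eqI: "q \<in> carrier F \<Longrightarrow> p - q \<in> N \<Longrightarrow> N +>\<^bsub>F\<^esub> p = N +>\<^bsub>F\<^esub> q"
  by (rule a_rcos_eqI[OF abelian_subgroup_submodule[OF module_F[OF K M] submodule_N[OF K M]]])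
     (simp_all add: F_sel[OF K M])

lemma tensor_coset_add:
  "p \<in> carrier F \<Longrightarrow> q \<in> carrier F \<Longrightarrow> N +>\<^bsub>F\<^esub> (p + q) = (N +>\<^bsub>F\<^esub> p) \<oplus>\<^bsub>T\<^esub> (N +>\<^bsub>F\<^esub> q)"
  using quot_module_add[OF module_F[OF K M] submodule_N[OF K M], of p q]
  by (simp add: F_sel[OF K M] tensor_module_pos_def tensor_module_def)

lemma tensor_coset_smult:
  "c \<in> K \<Longrightarrow> p \<in> carrier F \<Longrightarrow> N +>\<^bsub>F\<^esub> fscale c p = c \<odot>\<^bsub>T\<^esub> (N +>\<^bsub>F\<^esub> p)"
  using quot_module_smult[OF module_F[OF K M] submodule_N[OF K M], of c p]
  by (simp add: F_sel[OF K M] tensor_module_pos_def tensor_module_def subring_of_def)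

lemma pure_tensor_add:
  assumes "u \<in> L" "v \<in> L" "x \<in> carrier M" "y \<in> carrier M"
  shows "pure_tensor K M (u @ (x \<oplus>\<^bsub>M\<^esub> y) # v)
    = pure_tensor K M (u @ x # v) \<oplus>\<^bsub>T\<^esub> pure_tensor K M (u @ y # v)"
proof -
  have s: "Poly_Mapping.single (u @ z # v) 1 \<in> carrier F" if "z \<in> carrier M" for z
    using that assms by (intro single_in_F[OF K M]) (auto intro: cring_subring_ofD(2)[OF K])
  show ?thesis
    unfolding pure_tensor_def tensor_coset_add[OF s[OF assms(3)] s[OF assms(4)], symmetric]
    using gen_add[OF K M assms] s assms
    by (intro tensor_coset_eqI carrier_F_sub(1)[OF K M]) (auto simp: algebra_simps)
qed

lemma pure_tensor_smult:
  assumes "u \<in> L" "v \<in> L" "x \<in> carrier M" "c \<in> K"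
  shows "pure_tensor K M (u @ (c \<odot>\<^bsub>M\<^esub> x) # v) = c \<odot>\<^bsub>T\<^esub> pure_tensor K M (u @ x # v)"
proof -
  have s: "Poly_Mapping.single (u @ x # v) b \<in> carrier F" if "b \<in> K" for b
    using that assms by (intro single_in_F[OF K M]) auto
  show ?thesis
    unfolding pure_tensor_def tensor_coset_smult[OF assms(4) s[OF cring_subring_ofD(2)[OF K]], symmetric]
    using gen_smult[OF K M assms(1,2,4,3)] s[OF assms(4)]
    by (intro tensor_coset_eqI) (auto simp: fscale_simps)
qed

lemma module_M2: "module (subring_of K) (M2 K M)"
  unfolding M2_def by (rule module_sym_square(1)[OF K module_tensor_pos[OF K M]])

lemma eps_add:
  assumes "s \<in> carrier T" "s' \<in> carrier T" "t \<in> carrier T"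
  shows "eps K M (s \<oplus>\<^bsub>T\<^esub> s') t = eps K M s t \<oplus>\<^bsub>A\<^esub> eps K M s' t"
  using assms
  by (simp add: eps_def sym_prod_add[OF K module_tensor_pos[OF K M]] M2_def[symmetric]
      sym_incl_add[OF K module_M2] module_sym_square(2)[OF K module_tensor_pos[OF K M], folded M2_def])

lemma eps_smult:
  assumes "s \<in> carrier T" "t \<in> carrier T" "c \<in> K"
  shows "eps K M (c \<odot>\<^bsub>T\<^esub> s) t = sym_const K (M2 K M) c \<otimes>\<^bsub>A\<^esub> eps K M s t"
  using assms
  by (simp add: eps_def sym_prod_smult[OF K module_tensor_pos[OF K M]] M2_def[symmetric]
      sym_incl_smult[OF K module_M2] module_sym_square(2)[OF K module_tensor_pos[OF K M], folded M2_def])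

lemma eps_commute: "s \<in> carrier T \<Longrightarrow> t \<in> carrier T \<Longrightarrow> eps K M s t = eps K M t s"
  by (simp add: eps_def sym_prod_commute[OF K module_tensor_pos[OF K M]])

lemma submodule_eps_preimage:
  assumes B: "subring B A" "sym_const K (M2 K M) ` K \<subseteq> B" and t: "t \<in> carrier T"
  shows "submodule {s \<in> carrier T. eps K M s t \<in> B} (subring_of K) T"
  by (rule submodule_preimage_subring[OF K module_M2 module_tensor_pos[OF K M] B])
     (simp_all add: t eps_add eps_smult eps_closed[OF K M])

text \<open>
  Needed because the positive part of the tensor module is a span taken in the whole tensor module.
\<close>

lemma submodule_pos_imp_submodule:
  assumes Y: "submodule Y (subring_of K) T"
  shows "submodule Y (subring_of K) (tensor_module K M)"
proof -
  interpret T: module "subring_of K" T by (rule module_tensor_pos[OF K M])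
  note E = T.submoduleE[OF Y]
  have sel: "add T = add (tensor_module K M)" "smult T = smult (tensor_module K M)"
    "zero T = zero (tensor_module K M)" by (simp_all add: tensor_module_pos_def)
  have "\<zero>\<^bsub>tensor_module K M\<^esub> \<in> Y" using zero_in_submodule[OF Y] by (simp add: sel)
  moreover have "carrier T \<subseteq> carrier (tensor_module K M)"
    using module.submoduleE(1)[OF module_quot[OF module_F[OF K M] submodule_N[OF K M], folded tensor_module_def]
        submodule_tensor_pos[OF K M]] .
  ultimately show ?thesis
    using E(1,4,5) module_quot[OF module_F[OF K M] submodule_N[OF K M], folded tensor_module_def]
    by (intro subring_of_module_submoduleI) (auto simp: sel subring_of_def)
qed

lemma tensor_pos_generated:
  assumes Y: "submodule Y (subring_of K) T"
    and gen: "\<And>u. u \<in> L \<Longrightarrow> u \<noteq> [] \<Longrightarrow> pure_tensor K M u \<in> Y"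
  shows "carrier T \<subseteq> Y"
proof -
  have "{pure_tensor K M u | u. u \<in> L \<and> u \<noteq> []} \<subseteq> Y" using gen by blast
  from mod_span_least[OF submodule_pos_imp_submodule[OF Y] this] show ?thesis
    by (simp add: tensor_module_pos_def)
qed

text \<open>
  Four layers of generators are peeled off: elements of the symmetric square are spanned by
  symmetric products, tensors by pure tensors, and pure tensors, one letter at a time, by those with
  letters in \<open>X\<close>; the symmetric algebra is generated by the constants and the symmetric square.
\<close>

lemma sym_alg_M2_generated:
  assumes B: "subring B A" "sym_const K (M2 K M) ` K \<subseteq> B"
    and X: "X \<subseteq> carrier M" "mod_span K M X = carrier M"
    and gen: "\<And>u v. u \<in> lists X \<Longrightarrow> v \<in> lists X \<Longrightarrow> u \<noteq> [] \<Longrightarrow> v \<noteq> [] \<Longrightarrow>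
      eps K M (pure_tensor K M u) (pure_tensor K M v) \<in> B"
  shows "carrier A \<subseteq> B"
proof -
  note pos = pure_tensor_pos[OF K M]
  have LX: "w \<in> L" if "w \<in> lists X" for w using that X(1) by auto
  \<comment> \<open>\<open>u\<close> is the part of the word whose letters are still arbitrary; it is shortened from its end\<close>
  have letters: "eps K M (pure_tensor K M (u @ v)) t \<in> B"
    if "u \<in> L" "v \<in> lists X" "u @ v \<noteq> []" "t \<in> carrier T"
      and t: "\<And>w. w \<in> lists X \<Longrightarrow> w \<noteq> [] \<Longrightarrow> eps K M (pure_tensor K M w) t \<in> B" for u v t
    using that(1-3)
  proof (induction u arbitrary: v rule: rev_induct)
    case Nil
    then show ?case using t by simp
  next
    case (snoc x u)
    let ?Y = "{x \<in> carrier M. eps K M (pure_tensor K M (u @ x # v)) t \<in> B}"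
    have uv: "u \<in> L" "v \<in> L" using snoc.prems LX by auto
    have "submodule ?Y (subring_of K) M"
      by (rule submodule_preimage_subring[OF K module_M2 M B])
         (use uv that(4) in \<open>simp_all add: pure_tensor_add pure_tensor_smult eps_add eps_smult pos eps_closed[OF K M]\<close>)
    moreover have "X \<subseteq> ?Y"
    proof
      fix y assume "y \<in> X"
      then have "y \<in> carrier M" "y # v \<in> lists X" using X(1) snoc.prems(2) by auto
      with snoc.IH[OF uv(1) this(2)] show "y \<in> ?Y" by simp
    qed
    ultimately have "mod_span K M X \<subseteq> ?Y" by (rule mod_span_least)
    moreover have "x \<in> mod_span K M X" using X(2) snoc.prems(1) by simp
    ultimately show ?case by auto
  qed
  \<comment> \<open>one argument at a time; the second one follows by symmetry\<close>
  have tensors: "eps K M s t \<in> B"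
    if "s \<in> carrier T" "t \<in> carrier T"
      and "\<And>w. w \<in> lists X \<Longrightarrow> w \<noteq> [] \<Longrightarrow> eps K M (pure_tensor K M w) t \<in> B" for s t
    using tensor_pos_generated[OF submodule_eps_preimage[OF B that(2)]] letters[of _ "[]" t] that pos
    by auto
  have "eps K M s t \<in> B" if "s \<in> carrier T" "t \<in> carrier T" for s t
  proof (rule tensors[OF that])
    fix w assume w: "w \<in> lists X" "w \<noteq> []"
    then have P: "pure_tensor K M w \<in> carrier T" by (intro pos LX)
    have "eps K M t (pure_tensor K M w) \<in> B"
      by (rule tensors[OF that(2) P], rule gen) (use w in simp_all)
    then show "eps K M (pure_tensor K M w) t \<in> B" by (simp add: eps_commute[OF P that(2)])
  qed
  moreover have "submodule {x \<in> carrier (M2 K M). sym_incl K (M2 K M) x \<in> B} (subring_of K) (M2 K M)"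
    by (rule submodule_preimage_subring[OF K module_M2 module_M2 B])
       (simp_all add: sym_incl_closed[OF K module_M2] sym_incl_add[OF K module_M2] sym_incl_smult[OF K module_M2])
  ultimately have "carrier (M2 K M) \<subseteq> {x \<in> carrier (M2 K M). sym_incl K (M2 K M) x \<in> B}"
    unfolding M2_def
    by (intro sym_square_generated[OF K module_tensor_pos[OF K M]])
       (simp_all add: eps_def M2_def module_sym_square(2)[OF K module_tensor_pos[OF K M]])
  then show ?thesis
    using B by (intro sym_alg_generated[OF K module_M2]) auto
qed


section \<open>Generators of \<open>C2\<close>\<close>

lemma lookup_shuffle_words_Nil:
  "u \<noteq> [] \<or> v \<noteq> [] \<Longrightarrow> Poly_Mapping.lookup (shuffle_words u v :: 'm list \<Rightarrow>\<^sub>0 'a) [] = 0"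
  by (induction u v rule: shuffle_words.induct) (auto simp: lookup_single lookup_add lookup_prepend)

text \<open>
  A single generator of the ideal \<open>J2\<close>, read modulo a subring that contains all factors of its
  quadratic part.
\<close>

lemma eps_shuffle_associative_modulo:
  assumes B: "subring B A" and J: "J2 K M \<subseteq> B"
    and w: "f \<in> L" "g \<in> L" "h \<in> L" "f \<noteq> []" "g \<noteq> []" "h \<noteq> []"
    and left: "\<And>i j. i < length f \<Longrightarrow> j < length g \<Longrightarrow> 1 \<le> i + j \<Longrightarrow>
      eps K M (pure_tensor K M (drop i f)) (pure_tensor K M (drop j g)) \<in> B \<and>
      eps K M (shuffle K M (pure_tensor K M (take i f)) (pure_tensor K M (take j g))) (pure_tensor K M h) \<in> B"
    and right: "\<And>j k. j < length g \<Longrightarrow> k < length h \<Longrightarrow> 1 \<le> j + k \<Longrightarrow>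
      eps K M (pure_tensor K M f) (shuffle K M (pure_tensor K M (take j g)) (pure_tensor K M (take k h))) \<in> B \<and>
      eps K M (pure_tensor K M (drop j g)) (pure_tensor K M (drop k h)) \<in> B"
    and assoc: "eps K M (pure_tensor K M f) (shuffle K M (pure_tensor K M g) (pure_tensor K M h)) \<in> B"
  shows "eps K M (shuffle K M (pure_tensor K M f) (pure_tensor K M g)) (pure_tensor K M h) \<in> B"
proof -
  interpret A: cring A by (rule cring_sym_alg(2)[OF K module_M2])
  note E = subringE[OF B]
  let ?x = "eps K M (shuffle K M (pure_tensor K M f) (pure_tensor K M g)) (pure_tensor K M h)"
  let ?y = "eps K M (pure_tensor K M f) (shuffle K M (pure_tensor K M g) (pure_tensor K M h))"
  let ?s = "\<lambda>j. (\<Oplus>\<^bsub>A\<^esub>i\<in>{1 - j..<length f}. eps K M (pure_tensor K M (drop i f)) (pure_tensor K M (drop j g)) \<otimes>\<^bsub>A\<^esub>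
      eps K M (shuffle K M (pure_tensor K M (take i f)) (pure_tensor K M (take j g))) (pure_tensor K M h))"
  let ?t = "\<lambda>j. (\<Oplus>\<^bsub>A\<^esub>k\<in>{1 - j..<length h}. eps K M (pure_tensor K M f) (shuffle K M (pure_tensor K M (take j g)) (pure_tensor K M (take k h)))
      \<otimes>\<^bsub>A\<^esub> eps K M (pure_tensor K M (drop j g)) (pure_tensor K M (drop k h)))"
  let ?S = "\<Oplus>\<^bsub>A\<^esub>j\<in>{0..<length g}. ?s j \<ominus>\<^bsub>A\<^esub> ?t j"
  have "?s j \<in> B" if j: "j < length g" for j
  proof (rule A.finsum_in_subring[OF B])
    fix i assume "i \<in> {1 - j..<length f}"
    then have "i < length f" "1 \<le> i + j" by auto
    from left[OF this(1) j this(2)]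
    show "eps K M (pure_tensor K M (drop i f)) (pure_tensor K M (drop j g)) \<otimes>\<^bsub>A\<^esub>
        eps K M (shuffle K M (pure_tensor K M (take i f)) (pure_tensor K M (take j g))) (pure_tensor K M h) \<in> B"
      by (blast intro: E(6))
  qed
  moreover have "?t j \<in> B" if j: "j < length g" for j
  proof (rule A.finsum_in_subring[OF B])
    fix k assume "k \<in> {1 - j..<length h}"
    then have "k < length h" "1 \<le> j + k" by auto
    from right[OF j this]
    show "eps K M (pure_tensor K M f) (shuffle K M (pure_tensor K M (take j g)) (pure_tensor K M (take k h))) \<otimes>\<^bsub>A\<^esub>
        eps K M (pure_tensor K M (drop j g)) (pure_tensor K M (drop k h)) \<in> B"
      by (blast intro: E(6))
  qed
  ultimately have S: "?S \<in> B"
    by (intro A.finsum_in_subring[OF B]) (simp add: a_minus_def E(5,7))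
  have "J2_generator K M f g h \<in> J2 K M"
    unfolding J2_def by (rule subsetD[OF genideal_incl]) (use w in blast)
  then have gen: "(?x \<ominus>\<^bsub>A\<^esub> ?y) \<oplus>\<^bsub>A\<^esub> ?S \<in> B"
    using J by (auto simp: J2_generator_def Let_def)
  have x: "?x \<in> carrier A"
    using w by (intro eps_closed[OF K M] shuffle_pure_pos[OF K M] pure_tensor_pos[OF K M]) auto
  show ?thesis by (rule A.subring_diff_cancel[OF B x assoc S gen])
qed

text \<open>
  The relation for \<open>U\<close>, \<open>V\<close>, \<open>W\<close> has a quadratic part whose factors are of two kinds. One pairs final
  parts of two of the words and so lacks the third word. The other involves initial parts of two of
  the words that are never complete. Hence all factors have fewer letters than \<open>U\<close>, \<open>V\<close>, \<open>W\<close> together,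
  as the induction in \<open>words_paired_if_index_pairs_paired\<close> requires, while \<open>1 \<le> i + j\<close> keeps the empty
  tensor out of the symmetric products.
\<close>

lemma subring_C2_preimage_generated:
  fixes a :: "'i::linorder \<Rightarrow> 'm"
  assumes rat: "contains_rationals K"
    and a: "a ` I \<subseteq> carrier M" "mod_span K M (a ` I) = carrier M"
    and B: "subring B A" "sym_const K (M2 K M) ` K \<subseteq> B" "J2 K M \<subseteq> B"
    and index: "\<And>V W. (V, W) \<in> index_pairs I \<Longrightarrow> eps K M (pure_tensor K M (map a V)) (pure_tensor K M (map a W)) \<in> B"
  shows "carrier A \<subseteq> B"
proof -
  \<comment> \<open>representatives of tensors without a component in length \<open>0\<close>\<close>
  define Z where "Z = {p \<in> carrier F. Poly_Mapping.lookup p [] = 0}"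
  define G where "G p q \<longleftrightarrow> p \<in> Z \<and> q \<in> Z \<and> eps K M (N +>\<^bsub>F\<^esub> p) (N +>\<^bsub>F\<^esub> q) \<in> B" for p q
  have pos: "N +>\<^bsub>F\<^esub> p \<in> carrier T" if "p \<in> Z" for p
    using that by (simp add: Z_def coset_tensor_pos[OF K M])
  have map_L: "map a V \<in> L" if "V \<in> lists I" for V
    using that a(1) by (auto simp: image_subset_iff)
  have word_Z: "Poly_Mapping.single u 1 \<in> Z" if "u \<in> L" "u \<noteq> []" for u
    using that by (simp add: Z_def single_in_F[OF K M] cring_subring_ofD(2)[OF K] lookup_single)
  have shuffle_Z: "shuffle_words u v \<in> Z" if "u \<in> L" "v \<in> L" "u \<noteq> [] \<or> v \<noteq> []" for u v
    using that by (simp add: Z_def shuffle_words_F[OF K M] lookup_shuffle_words_Nil)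
  have G_words: "G (Poly_Mapping.single (map a V) 1) (Poly_Mapping.single (map a W) 1) \<longleftrightarrow>
      eps K M (pure_tensor K M (map a V)) (pure_tensor K M (map a W)) \<in> B"
    if "V \<in> lists I" "W \<in> lists I" "V \<noteq> []" "W \<noteq> []" for V W
    using that word_Z map_L by (simp add: G_def pure_tensor_def)
  have G_left: "G (shuffle_words u v) (Poly_Mapping.single w 1) \<longleftrightarrow>
      eps K M (shuffle K M (pure_tensor K M u) (pure_tensor K M v)) (pure_tensor K M w) \<in> B"
    if "u \<in> L" "v \<in> L" "u \<noteq> [] \<or> v \<noteq> []" "w \<in> L" "w \<noteq> []" for u v w
    using that word_Z shuffle_Z by (simp add: G_def shuffle_pure[OF K M]) (simp add: pure_tensor_def)
  have G_sym: "G q p" if "G p q" for p q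
    using that eps_commute[OF pos pos, of p q] by (simp add: G_def)
  have G_right: "G (Poly_Mapping.single w 1) (shuffle_words u v) \<longleftrightarrow>
      eps K M (pure_tensor K M w) (shuffle K M (pure_tensor K M u) (pure_tensor K M v)) \<in> B"
    if "u \<in> L" "v \<in> L" "u \<noteq> [] \<or> v \<noteq> []" "w \<in> L" "w \<noteq> []" for u v w
    using that word_Z shuffle_Z by (simp add: G_def shuffle_pure[OF K M]) (simp add: pure_tensor_def)
  note E = subringE[OF B(1)]
  have G_add: "G (p + p') q" if "G p q" "G p' q" for p p' q
    using that pos E(7)
    by (simp add: G_def Z_def lookup_add carrier_F_sub(1)[OF K M] tensor_coset_add eps_add)
  have G_scale: "G (fscale c p) q" if "c \<in> K" "G p q" for c p q
    using that pos E(6) B(2)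
    by (simp add: G_def Z_def carrier_F_sub(3)[OF K M] tensor_coset_smult eps_smult image_subset_iff)
  have "eps K M (pure_tensor K M (map a V)) (pure_tensor K M (map a W)) \<in> B"
    if VW: "V \<in> lists I" "W \<in> lists I" "V \<noteq> []" "W \<noteq> []" for V W
  proof -
    have "G (Poly_Mapping.single (map a V) 1) (Poly_Mapping.single (map a W) 1)"
    proof (rule words_paired_if_index_pairs_paired[OF K rat G_sym G_add G_scale _ _ VW])
      fix V W assume VW: "(V, W) \<in> index_pairs I"
      then have "V \<in> lists I" "W \<in> lists I" "V \<noteq> []" "W \<noteq> []" by (simp_all add: index_pairs_def)
      from G_words[OF this] index[OF VW]
      show "G (Poly_Mapping.single (map a V) 1) (Poly_Mapping.single (map a W) 1)" by simp
    next
      fix U V W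
      assume words: "U \<in> lists I" "V \<in> lists I" "W \<in> lists I" "U \<noteq> []" "V \<noteq> []" "W \<noteq> []"
        and shorter: "\<And>X Y. X \<in> lists I \<Longrightarrow> Y \<in> lists I \<Longrightarrow> X \<noteq> [] \<Longrightarrow> Y \<noteq> [] \<Longrightarrow>
          length X + length Y < length U + length V + length W \<Longrightarrow>
          G (Poly_Mapping.single (map a X) 1) (Poly_Mapping.single (map a Y) 1)"
        and assoc: "G (Poly_Mapping.single (map a U) 1) (shuffle_words (map a V) (map a W))"
      note L = words(1-3)[THEN map_L]
      have td: "take i X \<in> lists I" "drop i X \<in> lists I" if "X \<in> lists I" for X :: "'i list" and i
        using that by (auto dest: in_set_takeD in_set_dropD)
      have factors: "eps K M (pure_tensor K M (drop i (map a X))) (pure_tensor K M (drop j (map a Y))) \<in> B"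
        if "X \<in> lists I" "Y \<in> lists I" "i < length X" "j < length Y"
          "length X + length Y < length U + length V + length W" for X Y i j
        unfolding drop_map by (subst G_words[symmetric]; (intro td shorter)?) (use that in simp_all)
      have shuffles: "G (shuffle_words (map a (take i X)) (map a (take j Y))) (Poly_Mapping.single (map a Z) 1)"
        if "X \<in> lists I" "Y \<in> lists I" "Z \<in> lists I" "Z \<noteq> []" "i < length X" "j < length Y" "1 \<le> i + j"
          "length X + length Y + length Z \<le> length U + length V + length W" for X Y Z i j
      proof (rule shuffle_words_map_closed[OF K, where P = "\<lambda>p. G p (Poly_Mapping.single (map a Z) 1)"])
        fix w assume w: "w \<in> shuffles (take i X) (take j Y)"
        have len: "length w = i + j" using length_shuffles[OF w] that(5,6) by simp
        have "set w \<subseteq> set X \<union> set Y"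
          using set_shuffles[OF w] set_take_subset[of i X] set_take_subset[of j Y] by blast
        then have "w \<in> lists I" using that(1,2) by blast
        then show "G (Poly_Mapping.single (map a w) 1) (Poly_Mapping.single (map a Z) 1)"
          by (rule shorter[OF _ that(3) _ that(4)]) (use len that(5-8) in auto)
      qed (simp_all add: G_add G_scale)
      have "eps K M (shuffle K M (pure_tensor K M (map a U)) (pure_tensor K M (map a V))) (pure_tensor K M (map a W)) \<in> B"
      proof (rule eps_shuffle_associative_modulo[OF B(1,3) L])
        fix i j assume ij: "i < length (map a U)" "j < length (map a V)" "1 \<le> i + j"
        have "G (shuffle_words (map a (take i U)) (map a (take j V))) (Poly_Mapping.single (map a W) 1)"
          by (rule shuffles) (use words ij in simp_all)
        then have "eps K M (shuffle K M (pure_tensor K M (take i (map a U))) (pure_tensor K M (take j (map a V)))) (pure_tensor K M (map a W)) \<in> B"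
          unfolding take_map by (subst (asm) G_left; (intro map_L td)?) (use words ij in auto)
        with factors[OF words(1,2), of i j] words ij show "eps K M (pure_tensor K M (drop i (map a U))) (pure_tensor K M (drop j (map a V))) \<in> B \<and>
            eps K M (shuffle K M (pure_tensor K M (take i (map a U))) (pure_tensor K M (take j (map a V)))) (pure_tensor K M (map a W)) \<in> B"
          by simp
      next
        fix j k assume jk: "j < length (map a V)" "k < length (map a W)" "1 \<le> j + k"
        have "G (shuffle_words (map a (take j V)) (map a (take k W))) (Poly_Mapping.single (map a U) 1)"
          by (rule shuffles) (use words jk in simp_all)
        from G_sym[OF this]
        have "eps K M (pure_tensor K M (map a U)) (shuffle K M (pure_tensor K M (take j (map a V))) (pure_tensor K M (take k (map a W)))) \<in> B"
          unfolding take_map by (subst (asm) G_right; (intro map_L td)?) (use words jk in auto)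
        with factors[OF words(2,3), of j k] words jk show "eps K M (pure_tensor K M (map a U)) (shuffle K M (pure_tensor K M (take j (map a V))) (pure_tensor K M (take k (map a W)))) \<in> B \<and>
            eps K M (pure_tensor K M (drop j (map a V))) (pure_tensor K M (drop k (map a W))) \<in> B"
          by simp
      next
        show "eps K M (pure_tensor K M (map a U)) (shuffle K M (pure_tensor K M (map a V)) (pure_tensor K M (map a W))) \<in> B"
          using assoc words L by (simp add: G_right)
      qed (use words in auto)
      then show "G (shuffle_words (map a U) (map a V)) (Poly_Mapping.single (map a W) 1)"
        using words L by (simp add: G_left)
    qed
    then show ?thesis by (simp add: G_words VW)
  qed
  then show ?thesis
    by (intro sym_alg_M2_generated[OF B(1,2) a]) (auto simp: lists_image)
qed

lemma zero_C2: "\<zero>\<^bsub>C2 K M\<^esub> = J2 K M"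
  by (simp add: C2_def FactRing_def)

lemma carrier_C2: "carrier (C2 K M) = {J2 K M +>\<^bsub>A\<^esub> x | x. x \<in> carrier A}"
  by (auto simp: C2_def FactRing_def A_RCOSETS_def')

text \<open>
  The generated subalgebra is pulled back along the quotient map to a subring of the symmetric
  algebra. That subring contains \<open>J2\<close>, so that the defining relations become memberships in it.
\<close>

lemma C2_generated_by_index_pairs:
  fixes a :: "'i::linorder \<Rightarrow> 'm"
  assumes rat: "contains_rationals K"
    and a: "a ` I \<subseteq> carrier M" "mod_span K M (a ` I) = carrier M"
  shows "generates_algebra K (C2_const K M) (C2 K M) {C2_elem K M a V W | V W. (V, W) \<in> index_pairs I}"
proof -
  note C2 = cring_C2[OF K M]
  interpret C: cring "C2 K M" by (rule C2(2))
  interpret J: ideal "J2 K M" A by (rule C2(1))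
  interpret h: ring_hom_ring A "C2 K M" "(+>\<^bsub>A\<^esub>) (J2 K M)"
    using J.rcos_ring_hom_ring by (simp add: C2_def)
  let ?X = "C2_const K M ` K \<union> {C2_elem K M a V W | V W. (V, W) \<in> index_pairs I}"
  have "eps K M (pure_tensor K M (map a V)) (pure_tensor K M (map a W)) \<in> carrier A" if "(V, W) \<in> index_pairs I" for V W
  proof -
    have "V \<in> lists I" "W \<in> lists I" "V \<noteq> []" "W \<noteq> []" using that by (simp_all add: index_pairs_def)
    with a(1) show ?thesis
      by (intro eps_closed[OF K M] pure_tensor_pos[OF K M]) (auto simp: image_subset_iff)
  qed
  note closed = this sym_const_closed[OF K module_M2]
  have X: "?X \<subseteq> carrier (C2 K M)"
    using closed by (auto simp: C2_const_def C2_elem_def)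
  define B where "B = {x \<in> carrier A. J2 K M +>\<^bsub>A\<^esub> x \<in> generate_ring (C2 K M) ?X}"
  have sub: "subring (generate_ring (C2 K M) ?X) (C2 K M)" by (rule C.generate_ring_is_subring[OF X])
  have "carrier A \<subseteq> B"
  proof (rule subring_C2_preimage_generated[OF rat a])
    show "subring B A"
      unfolding B_def by (rule subring_preimage[OF h.ring_hom_ring_axioms sub])
    show "sym_const K (M2 K M) ` K \<subseteq> B"
      using closed by (auto simp: B_def C2_const_def intro!: generate_ring.incl)
    show "J2 K M \<subseteq> B"
    proof
      fix x assume x: "x \<in> J2 K M"
      then have "J2 K M +>\<^bsub>A\<^esub> x = J2 K M" by (rule J.a_rcos_const)
      also have "J2 K M = \<zero>\<^bsub>C2 K M\<^esub>" by (rule zero_C2[symmetric])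
      also have "\<dots> \<in> generate_ring (C2 K M) ?X" by (rule subringE(2)[OF sub])
      finally show "x \<in> B" unfolding B_def using J.Icarr[OF x] by blast
    qed
    show "eps K M (pure_tensor K M (map a V)) (pure_tensor K M (map a W)) \<in> B" if "(V, W) \<in> index_pairs I" for V W
    proof -
      have "C2_elem K M a V W \<in> generate_ring (C2 K M) ?X"
        by (rule generate_ring.incl) (use that in blast)
      with closed(1)[OF that] show ?thesis by (simp add: B_def C2_elem_def)
    qed
  qed
  then have "carrier (C2 K M) \<subseteq> generate_ring (C2 K M) ?X"
    unfolding carrier_C2 B_def by blast
  with C.generate_ring_incl[OF X] show ?thesis unfolding generates_algebra_def by (rule equalityI)
qed

end

theorem corollary36:
  fixes d Q :: "'a::comm_ring_1 \<Rightarrow> 'a" and I :: "'i::linorder set" and a :: "'i \<Rightarrow> 'a"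
  assumes "quasi_integration d Q"
    and "contains_rationals (constants d)"
    and "a ` I \<subseteq> carrier (kernel_module Q)"
    and "mod_span (constants d) (kernel_module Q) (a ` I) = carrier (kernel_module Q)"
  shows "generates_algebra (constants d) (C2_const (constants d) (kernel_module Q))
           (C2 (constants d) (kernel_module Q))
           {C2_elem (constants d) (kernel_module Q) a V W | V W. (V, W) \<in> index_pairs I}"
proof -
  interpret quasi_integration d Q by fact
  show ?thesis
    by (rule C2_generated_by_index_pairs[OF cring_constants module_kernel assms(2-4)])
qed

end
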